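(* For noise intensity $a>0$ let $\mathcal A^a(\omega)$ be the random $\tilde{\mathcal D}$-attractor of the random dynamical system $\Phi^a$ on $\ell^2$ generated by $$\frac{dU}{dt}=(\lambda+i\mu)\Lambda U-(\gamma+i\beta)U-(k+i\nu)e^{paz(\theta_t\omega)}|U|^pU+e^{-az(\theta_t\omega)}g+az(\theta_t\omega)U.$$ The random attractor is upper semi-continuous, that is, $$\lim_{a\to a_0}d_{\ell^2}\big(\mathcal A^a(\omega),\mathcal A^{a_0}(\omega)\big)=0\qquad\forall\,\omega\in\Omega\ \text{and}\ a_0\neq0$$ (noise intensities being positive, $a_0>0$).
   Context: $\ell^2$ is the complex Hilbert space of square-summable sequences $u=(u_j)_{j\in\mathbb Z}$, $u_j\in\mathbb C$, with norm $\|\cdot\|$; $(\Lambda u)_j=-u_{j-1}+2u_j-u_{j+1}$; $|u|^pu=(|u_j|^pu_j)_j$. Parameters: $\lambda,\gamma,k,p>0$, $\mu,\beta,\nu\in\mathbb R$, $\gamma>4\lambda$; the external force is $g=(g_j)_{j\in\mathbb Z}\in\ell^2$. $d_{\ell^2}(A,B)=\sup_{x\in A}\inf_{y\in B}\|x-y\|$. Probability space: $\Omega=\{\omega\in C(\mathbb R,\mathbb R):\omega(0)=0\}$ with the Borel $\sigma$-algebra $\mathcal F$ of the compact-open topology, two-sided Wiener measure $\mathbb P$, and shifts $\theta_t\omega(\cdot)=\omega(t+\cdot)-\omega(t)$. The Ornstein–Uhlenbeck process is $z(\theta_t\omega)=-\int_{-\infty}^0e^s(\theta_t\omega)(s)\,ds$;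 $\Omega$ is restricted to a $\theta$-invariant set of full measure on which $t\mapsto z(\theta_t\omega)$ is continuous, $\lim_{t\to\pm\infty}|z(\theta_t\omega)|/|t|=0$ and $\lim_{t\to\pm\infty}\frac1t\int_0^tz(\theta_s\omega)\,ds=0$. For $U_0\in\ell^2$, $\Phi^a(t,\omega)U_0$ is the value at time $t\ge0$ of the solution of the displayed random equation with $U(0)=U_0$. $\tilde{\mathcal D}$ is the universe of closed tempered random sets in $\ell^2$: families $\mathcal D=\{\mathcal D(\omega)\}$ with $\lim_{t\to+\infty}e^{-\rho t}\sup_{\phi\in\mathcal D(\theta_{-t}\omega)}\|\phi\|=0$ for all $\rho>0$. The random $\tilde{\mathcal D}$-attractor of $\Phi^a$ is the random compact set $\{\mathcal A^a(\omega)\}\in\tilde{\mathcal D}$ with $\Phi^a(t,\omega)\mathcal A^a(\omega)=\mathcal A^a(\theta_t\omega)$ for all $t\ge0$, $\omega\in\Omega$ and $\lim_{t\to\infty}d_{\ell^2}(\Phi^a(t,\theta_{-t}\omega)\mathcal D(\theta_{-t}\omega),\mathcal A^a(\omega))=0$ for all $\mathcal D\in\tilde{\mathcal D}$, $\omega\in\Omega$. *)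

theory Defs
  imports "HOL-Probability.Probability"
begin

typedef ell2 = "{u :: int \<Rightarrow> complex. (\<lambda>j. (cmod (u j))\<^sup>2) summable_on UNIV}"
  morphisms ell2_nth Abs_ell2
  by (rule exI[of _ "\<lambda>_. 0"]) simp

setup_lifting type_definition_ell2

lemma ell2_summable: "(\<lambda>j. (cmod (ell2_nth u j))\<^sup>2) summable_on UNIV"
  using ell2_nth[of u] by simp

lemma square_summable_add:
  fixes u v :: "int \<Rightarrow> complex"
  assumes "(\<lambda>j. (cmod (u j))\<^sup>2) summable_on UNIV" "(\<lambda>j. (cmod (v j))\<^sup>2) summable_on UNIV"
  shows "(\<lambda>j. (cmod (u j + v j))\<^sup>2) summable_on UNIV"
proof (rule summable_on_comparison_test)
  show "(\<lambda>j. 2 * (cmod (u j))\<^sup>2 + 2 * (cmod (v j))\<^sup>2) summable_on UNIV"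
    by (intro summable_on_add summable_on_cmult_right assms)
  fix j
  have "(cmod (u j + v j))\<^sup>2 \<le> (cmod (u j) + cmod (v j))\<^sup>2"
    by (intro power_mono norm_triangle_ineq) auto
  also have "\<dots> \<le> 2 * (cmod (u j))\<^sup>2 + 2 * (cmod (v j))\<^sup>2"
    using sum_squares_bound[of "cmod (u j)" "cmod (v j)"] by (simp add: power2_sum)
  finally show "(cmod (u j + v j))\<^sup>2 \<le> 2 * (cmod (u j))\<^sup>2 + 2 * (cmod (v j))\<^sup>2" .
qed simp

lemma square_summable_mult:
  fixes u :: "int \<Rightarrow> complex"
  assumes "(\<lambda>j. (cmod (u j))\<^sup>2) summable_on UNIV"
  shows "(\<lambda>j. (cmod (c * u j))\<^sup>2) summable_on UNIV"
  using summable_on_cmult_right[OF assms, of "(cmod c)\<^sup>2"]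
  by (simp add: norm_mult power_mult_distrib)

lemma square_summable_shift:
  fixes u :: "int \<Rightarrow> complex"
  assumes "(\<lambda>j. (cmod (u j))\<^sup>2) summable_on UNIV"
  shows "(\<lambda>j. (cmod (u (j + n)))\<^sup>2) summable_on UNIV"
  using summable_on_reindex_bij_betw[of "\<lambda>j. j + n" UNIV UNIV "\<lambda>j. (cmod (u j))\<^sup>2"] assms
  by (simp add: bij_plus_right)

lemma square_summable_inner:
  fixes u v :: "int \<Rightarrow> complex"
  assumes "(\<lambda>j. (cmod (u j))\<^sup>2) summable_on UNIV" "(\<lambda>j. (cmod (v j))\<^sup>2) summable_on UNIV"
  shows "(\<lambda>j. u j \<bullet> v j) summable_on UNIV"
proof -
  have "(\<lambda>j. norm (u j \<bullet> v j)) summable_on UNIV"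
  proof (rule Infinite_Sum.abs_summable_on_comparison_test')
  show "(\<lambda>j. (cmod (u j))\<^sup>2 + (cmod (v j))\<^sup>2) summable_on UNIV"
    by (intro summable_on_add assms)
  fix j
  have "\<bar>u j \<bullet> v j\<bar> \<le> cmod (u j) * cmod (v j)"
    by (rule Cauchy_Schwarz_ineq2)
  also have "\<dots> \<le> (cmod (u j))\<^sup>2 + (cmod (v j))\<^sup>2"
  proof -
    have "2 * (cmod (u j) * cmod (v j)) \<le> (cmod (u j))\<^sup>2 + (cmod (v j))\<^sup>2"
      using sum_squares_bound[of "cmod (u j)" "cmod (v j)"] by (simp add: mult.assoc)
    moreover have "0 \<le> cmod (u j) * cmod (v j)"
      by simp
    ultimately show ?thesis
      by linarith
  qed
  finally show "norm (u j \<bullet> v j) \<le> (cmod (u j))\<^sup>2 + (cmod (v j))\<^sup>2"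
    by simp
  qed
  then show ?thesis
    using summable_on_iff_abs_summable_on_real by blast
qed

text \<open>The real inner product below is the real part of the usual complex one; both induce the
  same norm, \<open>norm u = sqrt (\<Sum>j. (cmod (u j))\<^sup>2)\<close>.\<close>

instantiation ell2 :: real_inner
begin

lift_definition zero_ell2 :: ell2 is "\<lambda>_. 0" by simp

lift_definition plus_ell2 :: "ell2 \<Rightarrow> ell2 \<Rightarrow> ell2" is "\<lambda>u v j. u j + v j"
  by (rule square_summable_add)

lift_definition uminus_ell2 :: "ell2 \<Rightarrow> ell2" is "\<lambda>u j. - u j" by simp

lift_definition minus_ell2 :: "ell2 \<Rightarrow> ell2 \<Rightarrow> ell2" is "\<lambda>u v j. u j - v j"
  using square_summable_add[of _ "\<lambda>j. - _ j"] by simp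

lift_definition scaleR_ell2 :: "real \<Rightarrow> ell2 \<Rightarrow> ell2" is "\<lambda>r u j. r *\<^sub>R u j"
  unfolding scaleR_conv_of_real by (rule square_summable_mult)

lift_definition inner_ell2 :: "ell2 \<Rightarrow> ell2 \<Rightarrow> real" is "\<lambda>u v. \<Sum>\<^sub>\<infinity>j. u j \<bullet> v j" .

definition norm_ell2 :: "ell2 \<Rightarrow> real" where "norm_ell2 u = sqrt (u \<bullet> u)"

definition sgn_ell2 :: "ell2 \<Rightarrow> ell2" where "sgn_ell2 u = inverse (norm u) *\<^sub>R u"

definition dist_ell2 :: "ell2 \<Rightarrow> ell2 \<Rightarrow> real" where "dist_ell2 u v = norm (u - v)"

definition uniformity_ell2 :: "(ell2 \<times> ell2) filter"
  where "uniformity_ell2 = (INF e\<in>{0<..}. principal {(x, y). dist x y < e})"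

definition open_ell2 :: "ell2 set \<Rightarrow> bool"
  where "open_ell2 S \<longleftrightarrow> (\<forall>x\<in>S. \<forall>\<^sub>F (x', y) in uniformity. x' = x \<longrightarrow> y \<in> S)"

instance
proof
  fix u v w :: ell2 and r s :: real
  show "u + v + w = u + (v + w)" by transfer (simp add: add.assoc)
  show "u + v = v + u" by transfer (simp add: add.commute)
  show "0 + u = u" by transfer simp
  show "- u + u = 0" by transfer simp
  show "u - v = u + - v" by transfer simp
  show "r *\<^sub>R (u + v) = r *\<^sub>R u + r *\<^sub>R v" by transfer (simp add: scaleR_add_right)
  show "(r + s) *\<^sub>R u = r *\<^sub>R u + s *\<^sub>R u" by transfer (simp add: scaleR_add_left)
  show "r *\<^sub>R s *\<^sub>R u = (r * s) *\<^sub>R u" by transfer simp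
  show "1 *\<^sub>R u = u" by transfer simp
  show "sgn u = inverse (norm u) *\<^sub>R u" by (rule sgn_ell2_def)
  show "dist u v = norm (u - v)" by (rule dist_ell2_def)
  show "uniformity = (INF e\<in>{0<..}. principal {(x :: ell2, y). dist x y < e})"
    by (rule uniformity_ell2_def)
  show "open S \<longleftrightarrow> (\<forall>x\<in>S. \<forall>\<^sub>F (x', y) in uniformity. x' = x \<longrightarrow> y \<in> S)" for S :: "ell2 set"
    by (rule open_ell2_def)
  show "u \<bullet> v = v \<bullet> u" by transfer (simp add: inner_commute)
  show "(u + v) \<bullet> w = u \<bullet> w + v \<bullet> w"
    by transfer (simp add: inner_add_left infsum_add square_summable_inner)
  show "r *\<^sub>R u \<bullet> v = r * (u \<bullet> v)" by transfer (simp add: infsum_cmult_right')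
  show "0 \<le> u \<bullet> u" by transfer (simp add: infsum_nonneg)
  show "u \<bullet> u = 0 \<longleftrightarrow> u = 0"
  proof transfer
    fix u :: "int \<Rightarrow> complex"
    assume u: "(\<lambda>j. (cmod (u j))\<^sup>2) summable_on UNIV"
    have "u j = 0" if "(\<Sum>\<^sub>\<infinity>j. u j \<bullet> u j) = 0" for j
      using nonneg_infsum_le_0D[of "\<lambda>j. u j \<bullet> u j" UNIV j] that square_summable_inner[OF u u]
      by simp
    moreover have "(\<Sum>\<^sub>\<infinity>j. u j \<bullet> u j) = 0" if "u = (\<lambda>_. 0)"
      by (simp add: that)
    ultimately show "(\<Sum>\<^sub>\<infinity>j. u j \<bullet> u j) = 0 \<longleftrightarrow> u = (\<lambda>_. 0)"
      by blast
  qed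
  show "norm u = sqrt (u \<bullet> u)" by (rule norm_ell2_def)
qed

end

lemma norm_ell2_eq: "norm u = sqrt (\<Sum>\<^sub>\<infinity>j. (cmod (ell2_nth u j))\<^sup>2)"
  unfolding norm_ell2_def by transfer (simp add: power2_norm_eq_inner)

lift_definition scaleC_ell2 :: "complex \<Rightarrow> ell2 \<Rightarrow> ell2" (infixr "*\<^sub>C" 75)
  is "\<lambda>c u j. c * u j"
  by (rule square_summable_mult)

lift_definition lattice_Laplacian :: "ell2 \<Rightarrow> ell2"
  is "\<lambda>u j. - u (j - 1) + 2 * u j - u (j + 1)"
proof -
  fix u :: "int \<Rightarrow> complex"
  assume u: "(\<lambda>j. (cmod (u j))\<^sup>2) summable_on UNIV"
  have "(\<lambda>j. (cmod ((- 1 * u (j + - 1) + 2 * u j) + - 1 * u (j + 1)))\<^sup>2) summable_on UNIV"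
    by (intro square_summable_add square_summable_mult square_summable_shift u)
  then show "(\<lambda>j. (cmod (- u (j - 1) + 2 * u j - u (j + 1)))\<^sup>2) summable_on UNIV"
    by simp
qed

text \<open>For \<open>p \<ge> 0\<close> the sequence \<open>(|u_j|^p u_j)\<close> is square summable, see
  \<open>ell2_nth_power_nonlinearity\<close>.\<close>

definition power_nonlinearity :: "real \<Rightarrow> ell2 \<Rightarrow> ell2" where
  "power_nonlinearity p u = Abs_ell2 (\<lambda>j. of_real (cmod (ell2_nth u j) powr p) * ell2_nth u j)"

lemma cmod_ell2_nth_le_norm: "cmod (ell2_nth u j) \<le> norm u"
proof -
  have "(\<Sum>\<^sub>\<infinity>j\<in>{j}. (cmod (ell2_nth u j))\<^sup>2) \<le> (\<Sum>\<^sub>\<infinity>j. (cmod (ell2_nth u j))\<^sup>2)"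
    by (rule infsum_mono_neutral) (auto intro: ell2_summable)
  then have "(cmod (ell2_nth u j))\<^sup>2 \<le> (norm u)\<^sup>2"
    by (simp add: norm_ell2_eq infsum_nonneg)
  then show ?thesis
    by (rule power2_le_imp_le) simp
qed

lemma ell2_nth_power_nonlinearity:
  assumes "0 \<le> p"
  shows "ell2_nth (power_nonlinearity p u) j =
    of_real (cmod (ell2_nth u j) powr p) * ell2_nth u j"
proof -
  have "(\<lambda>j. (cmod (of_real (cmod (ell2_nth u j) powr p) * ell2_nth u j))\<^sup>2) summable_on UNIV"
  proof (rule summable_on_comparison_test)
    show "(\<lambda>j. (norm u powr p)\<^sup>2 * (cmod (ell2_nth u j))\<^sup>2) summable_on UNIV"
      by (intro summable_on_cmult_right ell2_summable)
    fix j
    have "cmod (ell2_nth u j) powr p \<le> norm u powr p"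
      using assms by (intro powr_mono2 cmod_ell2_nth_le_norm) auto
    then show "(cmod (of_real (cmod (ell2_nth u j) powr p) * ell2_nth u j))\<^sup>2
        \<le> (norm u powr p)\<^sup>2 * (cmod (ell2_nth u j))\<^sup>2"
      by (simp add: norm_mult power_mult_distrib mult_right_mono power_mono)
  qed simp
  then show ?thesis
    unfolding power_nonlinearity_def by (simp add: Abs_ell2_inverse)
qed

text \<open>The Hausdorff semi-distance \<open>d(A, B) = sup\<^sub>x\<^sub>\<in>\<^sub>A inf\<^sub>y\<^sub>\<in>\<^sub>B \<parallel>x - y\<parallel>\<close> takes values in
  \<open>[0, \<infinity>]\<close>, so that it is meaningful for unbounded sets as well.\<close>

definition semi_dist :: "ell2 set \<Rightarrow> ell2 set \<Rightarrow> ennreal" where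
  "semi_dist A B = (SUP x\<in>A. INF y\<in>B. ennreal (norm (x - y)))"


definition wiener_paths :: "(real \<Rightarrow> real) set" where
  "wiener_paths = {\<omega>. continuous_on UNIV \<omega> \<and> \<omega> 0 = 0}"

definition compact_open_topology :: "(real \<Rightarrow> real) topology" where
  "compact_open_topology =
     topology_generated_by {{\<omega> \<in> wiener_paths. \<omega> ` K \<subseteq> U} | K U. compact K \<and> open U}"

text \<open>Two-sided Wiener measure is characterised by independent increments with
  \<open>\<omega> t - \<omega> s \<sim> N(0, t - s)\<close> for \<open>s < t\<close> in the whole real line (recall \<open>\<omega> 0 = 0\<close>).\<close>

definition two_sided_wiener_measure :: "(real \<Rightarrow> real) measure \<Rightarrow> bool" where
  "two_sided_wiener_measure P \<longleftrightarrow>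
     prob_space P \<and>
     space P = wiener_paths \<and>
     sets P = sigma_sets wiener_paths {U. openin compact_open_topology U} \<and>
     (\<forall>s t. s < t \<longrightarrow>
        distributed P lborel (\<lambda>\<omega>. \<omega> t - \<omega> s) (normal_density 0 (sqrt (t - s)))) \<and>
     (\<forall>(n :: nat) \<tau>. strict_mono \<tau> \<longrightarrow>
        prob_space.indep_vars P (\<lambda>_. borel) (\<lambda>i \<omega>. \<omega> (\<tau> (Suc i)) - \<omega> (\<tau> i)) {..<n})"

definition shift :: "real \<Rightarrow> (real \<Rightarrow> real) \<Rightarrow> real \<Rightarrow> real" where
  "shift t \<omega> = (\<lambda>s. \<omega> (t + s) - \<omega> t)"

definition OU :: "(real \<Rightarrow> real) \<Rightarrow> real" where
  "OU \<omega> = - integral {..0} (\<lambda>s. exp s * \<omega> s)"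

text \<open>The shift-invariant sets of full measure to which the probability space may be restricted.
  That the integral defining the Ornstein--Uhlenbeck process exists is part of the process being
  well defined there.\<close>

definition admissible_paths :: "(real \<Rightarrow> real) measure \<Rightarrow> (real \<Rightarrow> real) set \<Rightarrow> bool" where
  "admissible_paths P \<Omega> \<longleftrightarrow>
     \<Omega> \<in> sets P \<and> measure P \<Omega> = 1 \<and>
     (\<forall>t. shift t ` \<Omega> = \<Omega>) \<and>
     (\<forall>\<omega>\<in>\<Omega>.
        (\<lambda>s. exp s * \<omega> s) integrable_on {..0} \<and>
        continuous_on UNIV (\<lambda>t. OU (shift t \<omega>)) \<and>
        ((\<lambda>t. \<bar>OU (shift t \<omega>)\<bar> / \<bar>t\<bar>) \<longlongrightarrow> 0) at_top \<and>
        ((\<lambda>t. \<bar>OU (shift t \<omega>)\<bar> / \<bar>t\<bar>) \<longlongrightarrow> 0) at_bot \<and>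
        ((\<lambda>t. 1 / t * (LBINT s=0..t. OU (shift s \<omega>))) \<longlongrightarrow> 0) at_top \<and>
        ((\<lambda>t. 1 / t * (LBINT s=0..t. OU (shift s \<omega>))) \<longlongrightarrow> 0) at_bot)"


text \<open>The argument \<open>x\<close> stands for the value of the Ornstein--Uhlenbeck process.\<close>

definition lattice_rhs ::
  "real \<Rightarrow> real \<Rightarrow> real \<Rightarrow> real \<Rightarrow> real \<Rightarrow> real \<Rightarrow> real \<Rightarrow> ell2 \<Rightarrow> real \<Rightarrow> real \<Rightarrow> ell2 \<Rightarrow> ell2" where
  "lattice_rhs l \<mu> \<gamma> \<beta> k \<nu> p g a x U =
     Complex l \<mu> *\<^sub>C lattice_Laplacian U - Complex \<gamma> \<beta> *\<^sub>C U
     - (Complex k \<nu> * of_real (exp (p * a * x))) *\<^sub>C power_nonlinearity p U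
     + exp (- a * x) *\<^sub>R g + (a * x) *\<^sub>R U"

text \<open>\<open>F x U\<close> is the right-hand side; \<open>\<Phi> t \<omega> U\<^sub>0\<close> is the value at time \<open>t \<ge> 0\<close> of the solution
  in \<open>ell2\<close> (differentiable in norm, one-sidedly at \<open>t = 0\<close>) starting at \<open>U\<^sub>0\<close>.\<close>

definition generated_by ::
  "(real \<Rightarrow> real) set \<Rightarrow> (real \<Rightarrow> ell2 \<Rightarrow> ell2) \<Rightarrow> (real \<Rightarrow> (real \<Rightarrow> real) \<Rightarrow> ell2 \<Rightarrow> ell2) \<Rightarrow> bool" where
  "generated_by \<Omega> F \<Phi> \<longleftrightarrow>
     (\<forall>\<omega>\<in>\<Omega>. \<forall>U\<^sub>0. \<Phi> 0 \<omega> U\<^sub>0 = U\<^sub>0 \<and>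
        (\<forall>t\<ge>0. ((\<lambda>t. \<Phi> t \<omega> U\<^sub>0) has_vector_derivative F (OU (shift t \<omega>)) (\<Phi> t \<omega> U\<^sub>0))
                  (at t within {0..})))"


text \<open>Measurability of a closed random set means measurability of the distance functions
  \<open>\<omega> \<mapsto> inf\<^sub>y\<^sub>\<in>\<^sub>D\<^sub>(\<^sub>\<omega>\<^sub>) \<parallel>x - y\<parallel>\<close>, with respect to the trace of the Borel sigma-algebra on \<open>\<Omega>\<close>.\<close>

definition closed_random_set ::
  "(real \<Rightarrow> real) measure \<Rightarrow> (real \<Rightarrow> real) set \<Rightarrow> ((real \<Rightarrow> real) \<Rightarrow> ell2 set) \<Rightarrow> bool" where
  "closed_random_set P \<Omega> D \<longleftrightarrow>
     (\<forall>\<omega>\<in>\<Omega>. closed (D \<omega>) \<and> D \<omega> \<noteq> {}) \<and>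
     (\<forall>x. (\<lambda>\<omega>. infdist x (D \<omega>)) \<in> borel_measurable (restrict_space P \<Omega>))"

definition tempered :: "(real \<Rightarrow> real) set \<Rightarrow> ((real \<Rightarrow> real) \<Rightarrow> ell2 set) \<Rightarrow> bool" where
  "tempered \<Omega> D \<longleftrightarrow>
     (\<forall>\<omega>\<in>\<Omega>. \<forall>\<rho>>0.
        ((\<lambda>t. ennreal (exp (- \<rho> * t)) * (SUP \<phi>\<in>D (shift (- t) \<omega>). ennreal (norm \<phi>))) \<longlongrightarrow> 0)
          at_top)"

definition tempered_universe ::
  "(real \<Rightarrow> real) measure \<Rightarrow> (real \<Rightarrow> real) set \<Rightarrow> ((real \<Rightarrow> real) \<Rightarrow> ell2 set) set" where
  "tempered_universe P \<Omega> = {D. closed_random_set P \<Omega> D \<and> tempered \<Omega> D}"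

definition random_attractor ::
  "(real \<Rightarrow> real) measure \<Rightarrow> (real \<Rightarrow> real) set \<Rightarrow>
   (real \<Rightarrow> (real \<Rightarrow> real) \<Rightarrow> ell2 \<Rightarrow> ell2) \<Rightarrow> ((real \<Rightarrow> real) \<Rightarrow> ell2 set) \<Rightarrow> bool" where
  "random_attractor P \<Omega> \<Phi> A \<longleftrightarrow>
     A \<in> tempered_universe P \<Omega> \<and>
     (\<forall>\<omega>\<in>\<Omega>. compact (A \<omega>)) \<and>
     (\<forall>\<omega>\<in>\<Omega>. \<forall>t\<ge>0. \<Phi> t \<omega> ` A \<omega> = A (shift t \<omega>)) \<and>
     (\<forall>D\<in>tempered_universe P \<Omega>. \<forall>\<omega>\<in>\<Omega>.
        ((\<lambda>t. semi_dist (\<Phi> t (shift (- t) \<omega>) ` D (shift (- t) \<omega>)) (A \<omega>)) \<longlongrightarrow> 0) at_top)"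

end

theory Submission
  imports Defs "HOL-Real_Asymp.Real_Asymp"
begin

text \<open>
  Why the theorem is true. The attractor \<open>A a \<omega>\<close> is the image of \<open>A a (shift (- t) \<omega>)\<close>
  under the flow \<open>\<Phi> a t\<close>, for each \<open>t \<ge> 0\<close>. Suppose that, for arbitrarily large \<open>t\<close>, all the sets
  \<open>A a (shift (- t) \<omega>)\<close> with \<open>a\<close> near \<open>a\<^sub>0\<close> are contained in \<open>D (shift (- t) \<omega>)\<close>, with one tempered
  random set \<open>D\<close>. Then \<open>\<Phi> a\<^sub>0 t\<close> maps them into a small neighbourhood of \<open>A a\<^sub>0 \<omega>\<close> if \<open>t\<close> is large
  enough, because \<open>A a\<^sub>0\<close> attracts \<open>D\<close>. Fix such a \<open>t\<close>. Over the finite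
  time \<open>t\<close>, \<open>\<Phi> a t\<close> differs little from \<open>\<Phi> a\<^sub>0 t\<close>, uniformly on bounded sets, when \<open>a\<close> is close to
  \<open>a\<^sub>0\<close>; hence \<open>A a \<omega>\<close> lies in a slightly larger neighbourhood. No compactness uniform in \<open>a\<close> enters:
  attraction by the single set \<open>A a\<^sub>0 \<omega>\<close> replaces it. Continuity in \<open>a\<close> is
  \<open>solution_lipschitz_in_intensity\<close>, a Gronwall argument; the common set \<open>D\<close> is constructed in
  \<open>common_tempered_set\<close>.

  The set \<open>D\<close> rests on the energy inequality
  \<open>(\<parallel>U\<parallel>\<^sup>2)' \<le> (2 a z - (\<gamma> - 4 l)) \<parallel>U\<parallel>\<^sup>2 + exp (- 2 a z) \<parallel>g\<parallel>\<^sup>2 / (\<gamma> - 4 l)\<close> of \<open>lattice_rhs_dissipative\<close>. Integrated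
  over a long past, it bounds the attractors uniformly in \<open>a\<close> provided that the noise integral
  \<open>Z(t) = \<integral>\<^sub>0\<^sup>t z\<close> does not overcome the damping. The required one-sided control of \<open>Z\<close> is obtained from the
  attractors themselves. The energy inequality is sharp: wave packets near the top \<open>4\<close> of the
  spectrum of the Laplacian, spread over so many sites that the nonlinearity does not see them, grow like
  \<open>exp (a Z(t) - (\<gamma> - 4 l) t)\<close> (\<open>instability\<close>). If these factors were unbounded when pulled back, no
  compact set could attract the unit ball. As there is an attractor for every \<open>a > 0\<close>, large \<open>a\<close> included,
  \<open>Z(- t) + \<delta> t\<close> tends to infinity for each \<open>\<delta> > 0\<close> (\<open>noise_integral_coercive\<close>).

  This leaves \<open>Z(- t)\<close> free to be very large, and then to drop, so that the attractors need not obey a uniform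
  bound at every time. At the times where \<open>Z(- t) + \<delta> t\<close> is minimal over the remaining past they do, and
  such favourable times are arbitrarily large. It suffices to let \<open>D\<close> contain the attractors at a sequence of
  favourable times, and to be trivial otherwise; as this prescribes \<open>D\<close> on countably many paths only,
  it is measurable.
\<close>

section \<open>The linear structure of the lattice\<close>

lemma ell2_eqI: "(\<And>j. ell2_nth u j = ell2_nth v j) \<Longrightarrow> u = v"
  by (simp add: ell2_nth_inject[symmetric] fun_eq_iff)

lemma norm_ell2_le_mult:
  assumes "0 \<le> C" and "\<And>j. cmod (ell2_nth u j) \<le> C * cmod (ell2_nth v j)"
  shows "norm u \<le> C * norm v"
proof -
  have "(\<Sum>\<^sub>\<infinity>j. (cmod (ell2_nth u j))\<^sup>2) \<le> (\<Sum>\<^sub>\<infinity>j. C\<^sup>2 * (cmod (ell2_nth v j))\<^sup>2)"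
  proof (rule infsum_mono)
    show "(cmod (ell2_nth u j))\<^sup>2 \<le> C\<^sup>2 * (cmod (ell2_nth v j))\<^sup>2" for j
      using power_mono[OF assms(2)[of j], of 2] by (simp add: power_mult_distrib)
  qed (intro ell2_summable summable_on_cmult_right)+
  then have "norm u \<le> sqrt (\<Sum>\<^sub>\<infinity>j. C\<^sup>2 * (cmod (ell2_nth v j))\<^sup>2)"
    unfolding norm_ell2_eq by (rule real_sqrt_le_mono)
  also have "\<dots> = C * norm v"
    using assms(1) by (simp add: norm_ell2_eq infsum_cmult_right' real_sqrt_mult)
  finally show ?thesis .
qed

lemma norm_scaleC_ell2: "norm (c *\<^sub>C u) = cmod c * norm u"
proof -
  have "(\<Sum>\<^sub>\<infinity>j. (cmod (c * ell2_nth u j))\<^sup>2) = (cmod c)\<^sup>2 * (\<Sum>\<^sub>\<infinity>j. (cmod (ell2_nth u j))\<^sup>2)"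
    by (simp add: norm_mult power_mult_distrib infsum_cmult_right')
  then show ?thesis
    by (simp add: norm_ell2_eq scaleC_ell2.rep_eq real_sqrt_mult)
qed

lemma norm_scaleC_ell2_le: "norm (c *\<^sub>C u) \<le> cmod c * norm u"
  by (simp add: norm_scaleC_ell2)

lemma bounded_linear_scaleC_ell2_left: "bounded_linear (\<lambda>c. c *\<^sub>C u)"
proof (rule bounded_linear_intro)
  show "(c + d) *\<^sub>C u = c *\<^sub>C u + d *\<^sub>C u" for c d
    by (rule ell2_eqI) (simp add: scaleC_ell2.rep_eq plus_ell2.rep_eq algebra_simps)
  show "(r *\<^sub>R c) *\<^sub>C u = r *\<^sub>R (c *\<^sub>C u)" for r c
    by (rule ell2_eqI) (simp add: scaleC_ell2.rep_eq scaleR_ell2.rep_eq)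
  show "norm (c *\<^sub>C u) \<le> norm c * norm u" for c
    by (rule norm_scaleC_ell2_le)
qed

lemma scaleC_ell2_diff: "c *\<^sub>C u - c *\<^sub>C v = c *\<^sub>C (u - v)"
  by (rule ell2_eqI) (simp add: scaleC_ell2.rep_eq minus_ell2.rep_eq algebra_simps)

lemma scaleC_ell2_diff_left: "c *\<^sub>C u - d *\<^sub>C u = (c - d) *\<^sub>C u"
  by (rule ell2_eqI) (simp add: scaleC_ell2.rep_eq minus_ell2.rep_eq algebra_simps)

lemma inner_scaleC_ell2: "inner (Complex r s *\<^sub>C u) v = r * inner u v + s * inner (\<i> *\<^sub>C u) v"
proof -
  have "Complex r s *\<^sub>C u = r *\<^sub>R u + s *\<^sub>R (\<i> *\<^sub>C u)"
    by (rule ell2_eqI)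
      (simp add: scaleC_ell2.rep_eq plus_ell2.rep_eq scaleR_ell2.rep_eq complex_eq_iff)
  then show ?thesis
    by (simp add: inner_add_left)
qed

lemma inner_imaginary_self: "inner (\<i> *\<^sub>C u) u = 0"
  by transfer (simp add: inner_complex_def mult.commute)

lemma inner_imaginary_right: "inner u (\<i> *\<^sub>C v) = - inner (\<i> *\<^sub>C u) v"
proof -
  have "(\<lambda>j. u j \<bullet> (\<i> * v j)) = (\<lambda>j. - ((\<i> * u j) \<bullet> v j))" for u v :: "int \<Rightarrow> complex"
    by (auto simp: inner_complex_def)
  then show ?thesis
    by transfer (simp add: infsum_uminus)
qed

lift_definition translate :: "int \<Rightarrow> ell2 \<Rightarrow> ell2" is "\<lambda>n u j. u (j + n)"
  by (rule square_summable_shift)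

lemma inner_translate: "inner (translate n u) (translate n v) = inner u v"
proof transfer
  fix n and u v :: "int \<Rightarrow> complex"
  show "(\<Sum>\<^sub>\<infinity>j. u (j + n) \<bullet> v (j + n)) = (\<Sum>\<^sub>\<infinity>j. u j \<bullet> v j)"
    by (rule infsum_reindex_bij_betw[where g = "\<lambda>j. j + n" and f = "\<lambda>j. u j \<bullet> v j"])
      (simp add: bij_plus_right)
qed

lemma norm_translate: "norm (translate n u) = norm u"
  by (simp add: norm_eq_sqrt_inner inner_translate)

lemma inner_translate_minus: "inner (translate (- n) u) v = inner u (translate n v)"
proof -
  have "translate n (translate (- n) u) = u"
    by (rule ell2_eqI) (simp add: translate.rep_eq)
  then show ?thesis
    using inner_translate[of n "translate (- n) u" v] by simp
qed

lemma lattice_Laplacian_eq: "lattice_Laplacian u = 2 *\<^sub>R u - translate 1 u - translate (- 1) u"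
  by (rule ell2_eqI)
    (simp add: lattice_Laplacian.rep_eq translate.rep_eq scaleR_ell2.rep_eq minus_ell2.rep_eq
      scaleR_conv_of_real)

lemma norm_lattice_Laplacian_le: "norm (lattice_Laplacian u) \<le> 4 * norm u"
proof -
  have "norm (lattice_Laplacian u) \<le> norm (2 *\<^sub>R u) + norm (translate 1 u) + norm (translate (- 1) u)"
    unfolding lattice_Laplacian_eq by norm
  then show ?thesis
    by (simp add: norm_translate)
qed

lemma lattice_Laplacian_diff: "lattice_Laplacian u - lattice_Laplacian v = lattice_Laplacian (u - v)"
  by (rule ell2_eqI) (simp add: lattice_Laplacian.rep_eq minus_ell2.rep_eq algebra_simps)

text \<open>The lattice Laplacian is symmetric: the two translates are adjoint to each other. Hence the
  dispersive coefficient \<open>\<mu>\<close> does no work in the energy balance.\<close>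

lemma inner_imaginary_lattice_Laplacian: "inner (\<i> *\<^sub>C lattice_Laplacian u) u = 0"
proof -
  have 1: "\<i> *\<^sub>C lattice_Laplacian u =
      2 *\<^sub>R (\<i> *\<^sub>C u) - translate 1 (\<i> *\<^sub>C u) - translate (- 1) (\<i> *\<^sub>C u)"
    by (rule ell2_eqI)
      (simp add: lattice_Laplacian.rep_eq scaleC_ell2.rep_eq translate.rep_eq scaleR_ell2.rep_eq
        minus_ell2.rep_eq plus_ell2.rep_eq scaleR_conv_of_real algebra_simps)
  have 2: "translate 1 (\<i> *\<^sub>C u) = \<i> *\<^sub>C translate 1 u"
    by (rule ell2_eqI) (simp add: scaleC_ell2.rep_eq translate.rep_eq)
  have "inner (translate (- 1) (\<i> *\<^sub>C u)) u = - inner (translate 1 (\<i> *\<^sub>C u)) u"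
    by (metis 2 inner_commute inner_imaginary_right inner_translate_minus)
  then show ?thesis
    by (simp add: 1 inner_diff_left inner_imaginary_self)
qed

text \<open>With its sign convention the Laplacian is nonnegative with spectrum \<open>[0, 4]\<close>, so that
  the term \<open>l \<Lambda>\<close> feeds energy into the system, at rate at most \<open>4 l\<close>.\<close>

lemma inner_lattice_Laplacian_le:
  assumes "0 \<le> l"
  shows "inner (Complex l \<mu> *\<^sub>C lattice_Laplacian u) u \<le> 4 * l * (norm u)\<^sup>2"
proof -
  have "inner (lattice_Laplacian u) u \<le> norm (lattice_Laplacian u) * norm u"
    by (rule norm_cauchy_schwarz)
  also have "\<dots> \<le> 4 * norm u * norm u"
    by (intro mult_right_mono norm_lattice_Laplacian_le) simp
  finally have "l * inner (lattice_Laplacian u) u \<le> l * (4 * norm u * norm u)"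
    by (intro mult_left_mono assms)
  then show ?thesis
    by (simp add: inner_scaleC_ell2 inner_imaginary_lattice_Laplacian power2_eq_square ac_simps)
qed

section \<open>Energy balance and Lipschitz bounds of the vector field\<close>

lemma inner_power_nonlinearity_nonneg:
  assumes "0 \<le> k" "0 \<le> p" "0 \<le> r"
  shows "0 \<le> inner ((Complex k \<nu> * of_real r) *\<^sub>C power_nonlinearity p u) u"
proof -
  have "0 \<le> (Complex k \<nu> * of_real r * (of_real s * w)) \<bullet> w" if "0 \<le> s" for s and w :: complex
  proof -
    have "(Complex k \<nu> * of_real r * (of_real s * w)) \<bullet> w = k * r * s * (w \<bullet> w)"
      by (simp add: inner_complex_def algebra_simps)
    then show ?thesis
      using assms that by simp
  qed
  then show ?thesis
    unfolding inner_ell2.rep_eq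
    by (intro infsum_nonneg)
      (simp add: scaleC_ell2.rep_eq ell2_nth_power_nonlinearity[OF assms(2)])
qed

text \<open>The energy balance. The damping \<open>\<gamma>\<close> exceeds the largest possible gain \<open>4 l\<close> of the Laplacian,
  the power term dissipates, and the forcing is absorbed by Young's inequality at the price of half
  of the spectral gap \<open>\<gamma> - 4 l\<close>.\<close>

lemma lattice_rhs_dissipative:
  assumes "0 < l" "0 < k" "0 < p" "4 * l < \<gamma>"
  shows "2 * inner U (lattice_rhs l \<mu> \<gamma> \<beta> k \<nu> p g a x U) \<le>
    (2 * a * x - (\<gamma> - 4 * l)) * (norm U)\<^sup>2 + exp (- 2 * a * x) * (norm g)\<^sup>2 / (\<gamma> - 4 * l)"
proof -
  define d where "d = \<gamma> - 4 * l"
  have d: "0 < d" using assms by (simp add: d_def)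
  have young: "2 * (q * r) \<le> d * q\<^sup>2 + r\<^sup>2 / d" for q r :: real
  proof -
    have "0 \<le> (d * q - r)\<^sup>2 / d" using d by simp
    then show ?thesis using d by (simp add: power2_eq_square field_simps)
  qed
  have "inner U g \<le> norm U * norm g" by (rule norm_cauchy_schwarz)
  then have "2 * (exp (- a * x) * inner U g) \<le> 2 * (exp (- a * x) * (norm U * norm g))"
    by simp
  also have "\<dots> = 2 * (norm U * (exp (- a * x) * norm g))"
    by simp
  also have "\<dots> \<le> d * (norm U)\<^sup>2 + (exp (- a * x) * norm g)\<^sup>2 / d"
    by (rule young)
  also have "(exp (- a * x) * norm g)\<^sup>2 = exp (- 2 * a * x) * (norm g)\<^sup>2"
    using exp_double[of "- a * x"] by (simp add: power_mult_distrib mult.assoc)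
  finally have 1: "2 * (exp (- a * x) * inner U g) \<le> d * (norm U)\<^sup>2 + exp (- 2 * a * x) * (norm g)\<^sup>2 / d" .
  have 2: "inner (Complex \<gamma> \<beta> *\<^sub>C U) U = \<gamma> * (norm U)\<^sup>2"
    by (simp add: inner_scaleC_ell2 inner_imaginary_self power2_norm_eq_inner)
  have 3: "inner (Complex l \<mu> *\<^sub>C lattice_Laplacian U) U \<le> 4 * l * (norm U)\<^sup>2"
    using assms by (intro inner_lattice_Laplacian_le) simp
  have 4: "0 \<le> inner ((Complex k \<nu> * of_real (exp (p * a * x))) *\<^sub>C power_nonlinearity p U) U"
    using assms by (intro inner_power_nonlinearity_nonneg) simp_all
  have "inner U (lattice_rhs l \<mu> \<gamma> \<beta> k \<nu> p g a x U) =
      inner (Complex l \<mu> *\<^sub>C lattice_Laplacian U) U - inner (Complex \<gamma> \<beta> *\<^sub>C U) U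
      - inner ((Complex k \<nu> * of_real (exp (p * a * x))) *\<^sub>C power_nonlinearity p U) U
      + exp (- a * x) * inner U g + a * x * (norm U)\<^sup>2"
    unfolding lattice_rhs_def inner_add_right inner_diff_right inner_scaleR_right power2_norm_eq_inner
    by (simp only: inner_commute)
  with 2 have "2 * inner U (lattice_rhs l \<mu> \<gamma> \<beta> k \<nu> p g a x U) \<le>
      2 * (4 * l * (norm U)\<^sup>2) - 2 * (\<gamma> * (norm U)\<^sup>2)
      + (d * (norm U)\<^sup>2 + exp (- 2 * a * x) * (norm g)\<^sup>2 / d) + 2 * (a * x * (norm U)\<^sup>2)"
    using 1 3 4 by linarith
  also have "\<dots> = (2 * a * x - d) * (norm U)\<^sup>2 + exp (- 2 * a * x) * (norm g)\<^sup>2 / d"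
    by (simp add: d_def left_diff_distrib)
  finally show ?thesis
    by (simp add: d_def)
qed

lemma abs_exp_diff_le:
  fixes u v m :: real
  assumes "u \<le> m" "v \<le> m"
  shows "\<bar>exp u - exp v\<bar> \<le> exp m * \<bar>u - v\<bar>"
proof -
  have *: "exp y - exp x \<le> exp m * (y - x)" if "x \<le> y" "y \<le> m" for x y :: real
  proof -
    have "exp y - exp x = exp y * (1 - exp (x - y))"
      by (simp add: exp_diff field_simps)
    also have "\<dots> \<le> exp y * (y - x)"
    proof (rule mult_left_mono)
      show "1 - exp (x - y) \<le> y - x"
        using exp_ge_add_one_self[of "x - y"] by linarith
    qed simp
    also have "\<dots> \<le> exp m * (y - x)"
      using that by (intro mult_right_mono) auto
    finally show ?thesis .
  qed
  show ?thesis
    using *[of u v] *[of v u] assms by (cases "u \<le> v") auto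
qed

text \<open>The mean value theorem for \<open>s powr p\<close> produces \<open>z powr (p - 1)\<close>, which is unbounded near \<open>0\<close>
  when \<open>p < 1\<close>; the factor \<open>cmod v \<le> z\<close> that accompanies it turns it into \<open>z powr p\<close>.\<close>

lemma norm_powr_mult_diff_le:
  fixes u v :: complex
  assumes "0 < p" "cmod u \<le> M" "cmod v \<le> M"
  shows "cmod (of_real (cmod u powr p) * u - of_real (cmod v powr p) * v)
    \<le> (p + 1) * M powr p * cmod (u - v)"
proof -
  have *: "cmod (of_real (cmod u powr p) * u - of_real (cmod v powr p) * v)
      \<le> (p + 1) * M powr p * cmod (u - v)"
    if le: "cmod v \<le> cmod u" "cmod u \<le> M" for u v
  proof -
    define r s where "r = cmod v" and "s = cmod u"
    have rs: "0 \<le> r" "r \<le> s" "s \<le> M" using le by (simp_all add: r_def s_def)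
    have sM: "s powr p \<le> M powr p" using rs assms by (intro powr_mono2) auto
    have "(s powr p - r powr p) * r \<le> p * M powr p * (s - r)"
    proof (cases "r = 0 \<or> r = s")
      case True
      then show ?thesis using rs assms by auto
    next
      case False
      then have "0 < r" "r < s" using rs by auto
      have "\<exists>z>r. z < s \<and> s powr p - r powr p = (s - r) * (p * z powr (p - 1))"
      proof (rule MVT2[OF \<open>r < s\<close>])
        show "((\<lambda>x. x powr p) has_real_derivative p * x powr (p - 1)) (at x)" if "r \<le> x" for x
          using that \<open>0 < r\<close> by (intro has_real_derivative_powr) auto
      qed
      then obtain z where z: "r < z" "z < s" "s powr p - r powr p = (s - r) * (p * z powr (p - 1))"
        by blast
      have "z powr (p - 1) * r \<le> z powr (p - 1) * z"
        using z by (intro mult_left_mono) auto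
      also have "\<dots> = z powr p"
        using z \<open>0 < r\<close> by (simp add: powr_mult_base powr_diff)
      also have "\<dots> \<le> M powr p"
        using z rs \<open>0 < r\<close> assms by (intro powr_mono2) auto
      finally have "(s - r) * p * (z powr (p - 1) * r) \<le> (s - r) * p * M powr p"
        using rs assms by (intro mult_left_mono) auto
      then show ?thesis
        unfolding z(3) by (simp add: ac_simps)
    qed
    also have "\<dots> \<le> p * M powr p * cmod (u - v)"
      using assms norm_triangle_ineq2[of u v] by (intro mult_left_mono) (auto simp: r_def s_def)
    finally have 1: "(s powr p - r powr p) * r \<le> p * M powr p * cmod (u - v)" .
    have "of_real (s powr p) * u - of_real (r powr p) * v
        = of_real (s powr p) * (u - v) + of_real (s powr p - r powr p) * v"
      by (simp add: algebra_simps)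
    also have "cmod \<dots> \<le> cmod (of_real (s powr p) * (u - v)) + cmod (of_real (s powr p - r powr p) * v)"
      by (rule norm_triangle_ineq)
    also have "\<dots> = s powr p * cmod (u - v) + (s powr p - r powr p) * r"
    proof -
      have "r powr p \<le> s powr p" using rs assms by (intro powr_mono2) auto
      then have "cmod (of_real (s powr p - r powr p)) = s powr p - r powr p"
        unfolding norm_of_real by simp
      then show ?thesis by (simp only: norm_mult) (simp add: r_def)
    qed
    also have "\<dots> \<le> M powr p * cmod (u - v) + p * M powr p * cmod (u - v)"
      by (intro add_mono 1 mult_right_mono sM) auto
    finally show ?thesis
      by (simp add: r_def s_def algebra_simps)
  qed
  show ?thesis
    using *[of v u] *[of u v] assms by (cases "cmod v \<le> cmod u") (auto simp: norm_minus_commute)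
qed

lemma norm_power_nonlinearity_diff_le:
  assumes "0 < p" "norm U \<le> M" "norm V \<le> M"
  shows "norm (power_nonlinearity p U - power_nonlinearity p V) \<le> (p + 1) * M powr p * norm (U - V)"
proof (rule norm_ell2_le_mult)
  show "0 \<le> (p + 1) * M powr p" using assms by simp
  show "cmod (ell2_nth (power_nonlinearity p U - power_nonlinearity p V) j)
      \<le> (p + 1) * M powr p * cmod (ell2_nth (U - V) j)" for j
    using norm_powr_mult_diff_le[of p "ell2_nth U j" M "ell2_nth V j"] assms
      cmod_ell2_nth_le_norm[of U j] cmod_ell2_nth_le_norm[of V j]
    by (simp add: minus_ell2.rep_eq ell2_nth_power_nonlinearity)
qed

lemma norm_power_nonlinearity_le:
  assumes "0 < p" "norm U \<le> M"
  shows "norm (power_nonlinearity p U) \<le> (p + 1) * M powr p * norm U"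
proof -
  have "power_nonlinearity p 0 = 0"
    using assms by (intro ell2_eqI) (simp add: ell2_nth_power_nonlinearity zero_ell2.rep_eq)
  then show ?thesis
    using norm_power_nonlinearity_diff_le[OF assms, of 0] assms norm_ge_zero[of U]
    by (simp del: norm_ge_zero)
qed

text \<open>The right-hand side is Lipschitz on bounded sets of states, jointly in the state and in the
  noise intensity, as long as the value of the noise stays bounded. This is what makes solutions
  over a fixed finite time depend continuously on the intensity, uniformly on bounded sets of
  initial data.\<close>

lemma lattice_rhs_lipschitz:
  assumes "0 < p" "0 \<le> b" "0 \<le> M" "0 \<le> Z"
  obtains L K where "0 \<le> L" "0 \<le> K"
    and "\<And>a a' x U V. \<lbrakk>0 \<le> a; a \<le> b; 0 \<le> a'; a' \<le> b; \<bar>x\<bar> \<le> Z; norm U \<le> M; norm V \<le> M\<rbrakk> \<Longrightarrow>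
      norm (lattice_rhs l \<mu> \<gamma> \<beta> k \<nu> p g a x U - lattice_rhs l \<mu> \<gamma> \<beta> k \<nu> p g a' x V)
        \<le> L * norm (U - V) + K * \<bar>a - a'\<bar>"
proof
  define N where "N = power_nonlinearity p"
  define E where "E = exp (p * (b * Z))"
  define Lp where "Lp = (p + 1) * M powr p"
  define L where "L = cmod (Complex l \<mu>) * 4 + cmod (Complex \<gamma> \<beta>) + cmod (Complex k \<nu>) * E * Lp + b * Z"
  define K where "K = cmod (Complex k \<nu>) * (E * (p * Z)) * (Lp * M) + exp (b * Z) * Z * norm g + Z * M"
  have nn: "0 \<le> E" "0 \<le> Lp" using assms by (simp_all add: E_def Lp_def)
  show "0 \<le> L" "0 \<le> K"
    using assms nn by (simp_all add: L_def K_def)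
  fix a a' x :: real and U V :: ell2
  assume a: "0 \<le> a" "a \<le> b" "0 \<le> a'" "a' \<le> b" and x: "\<bar>x\<bar> \<le> Z" and UV: "norm U \<le> M" "norm V \<le> M"
  have ax: "\<bar>c * x\<bar> \<le> b * Z" if "0 \<le> c" "c \<le> b" for c
    using that x by (simp add: abs_mult mult_mono)
  have pax: "p * c * x \<le> p * (b * Z)" if "0 \<le> c" "c \<le> b" for c
    using ax[OF that] assms by (simp add: mult.assoc mult_left_mono)
  define e e' where "e = exp (p * a * x)" and "e' = exp (p * a' * x)"
  have e: "0 \<le> e" "e \<le> E"
    using pax[OF a(1,2)] by (simp_all add: e_def E_def)
  have dx: "\<bar>a * x - a' * x\<bar> \<le> Z * \<bar>a - a'\<bar>"
    using x by (simp add: abs_mult mult_right_mono mult.commute flip: left_diff_distrib)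
  have "\<bar>e - e'\<bar> \<le> E * \<bar>p * a * x - p * a' * x\<bar>"
    unfolding e_def e'_def E_def by (intro abs_exp_diff_le pax a)
  also have "\<dots> = E * (p * \<bar>a * x - a' * x\<bar>)"
    using assms by (simp add: abs_mult mult.assoc flip: right_diff_distrib)
  also have "\<dots> \<le> E * (p * (Z * \<bar>a - a'\<bar>))"
    using assms dx nn by (intro mult_left_mono) auto
  finally have de: "\<bar>e - e'\<bar> \<le> E * (p * Z) * \<bar>a - a'\<bar>"
    by (simp add: mult.assoc)
  have "\<bar>exp (- a * x) - exp (- a' * x)\<bar> \<le> exp (b * Z) * \<bar>- a * x - - a' * x\<bar>"
    using ax[OF a(1,2)] ax[OF a(3,4)] by (intro abs_exp_diff_le) auto
  also have "\<bar>- a * x - - a' * x\<bar> = \<bar>a * x - a' * x\<bar>"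
    by simp
  also have "exp (b * Z) * \<dots> \<le> exp (b * Z) * (Z * \<bar>a - a'\<bar>)"
    using dx by (intro mult_left_mono) auto
  finally have dg: "\<bar>exp (- a * x) - exp (- a' * x)\<bar> \<le> exp (b * Z) * Z * \<bar>a - a'\<bar>"
    by (simp add: mult.assoc)
  define t1 where "t1 = Complex l \<mu> *\<^sub>C lattice_Laplacian (U - V)"
  define t2 where "t2 = Complex \<gamma> \<beta> *\<^sub>C (U - V)"
  define t3 where "t3 = (Complex k \<nu> * of_real e) *\<^sub>C (N U - N V)"
  define t4 where "t4 = (Complex k \<nu> * of_real (e - e')) *\<^sub>C N V"
  define t5 where "t5 = (exp (- a * x) - exp (- a' * x)) *\<^sub>R g"
  define t6 where "t6 = (a * x) *\<^sub>R (U - V)"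
  define t7 where "t7 = (a * x - a' * x) *\<^sub>R V"
  have "lattice_rhs l \<mu> \<gamma> \<beta> k \<nu> p g a x U - lattice_rhs l \<mu> \<gamma> \<beta> k \<nu> p g a' x V
      = t1 - t2 - t3 - t4 + t5 + t6 + t7"
  proof -
    have "Complex l \<mu> *\<^sub>C lattice_Laplacian U = t1 + Complex l \<mu> *\<^sub>C lattice_Laplacian V"
      unfolding t1_def lattice_Laplacian_diff[symmetric] scaleC_ell2_diff[symmetric] by simp
    moreover have "Complex \<gamma> \<beta> *\<^sub>C U = t2 + Complex \<gamma> \<beta> *\<^sub>C V"
      unfolding t2_def scaleC_ell2_diff[symmetric] by simp
    moreover have "(Complex k \<nu> * of_real e) *\<^sub>C N U = t3 + t4 + (Complex k \<nu> * of_real e') *\<^sub>C N V"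
      unfolding t3_def t4_def of_real_diff right_diff_distrib scaleC_ell2_diff_left[symmetric]
        scaleC_ell2_diff[symmetric] by simp
    ultimately show ?thesis
      unfolding lattice_rhs_def N_def[symmetric] e_def[symmetric] e'_def[symmetric]
      by (simp add: t5_def t6_def t7_def algebra_simps)
  qed
  also have "norm \<dots> \<le> norm t1 + norm t2 + norm t3 + norm t4 + norm t5 + norm t6 + norm t7"
    by norm
  also have "\<dots> \<le> cmod (Complex l \<mu>) * (4 * norm (U - V)) + cmod (Complex \<gamma> \<beta>) * norm (U - V)
      + cmod (Complex k \<nu>) * E * (Lp * norm (U - V))
      + cmod (Complex k \<nu>) * (E * (p * Z) * \<bar>a - a'\<bar>) * (Lp * M)
      + exp (b * Z) * Z * \<bar>a - a'\<bar> * norm g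
      + b * Z * norm (U - V) + Z * \<bar>a - a'\<bar> * M"
  proof (intro add_mono)
    show "norm t1 \<le> cmod (Complex l \<mu>) * (4 * norm (U - V))"
      unfolding t1_def
      by (intro order_trans[OF norm_scaleC_ell2_le] mult_left_mono norm_lattice_Laplacian_le) simp
    show "norm t2 \<le> cmod (Complex \<gamma> \<beta>) * norm (U - V)"
      unfolding t2_def by (rule norm_scaleC_ell2_le)
    have "norm t3 \<le> cmod (Complex k \<nu> * of_real e) * norm (N U - N V)"
      unfolding t3_def by (rule norm_scaleC_ell2_le)
    also have "\<dots> \<le> cmod (Complex k \<nu>) * E * (Lp * norm (U - V))"
      using e nn assms UV unfolding norm_mult norm_of_real Lp_def N_def
      by (intro mult_mono norm_power_nonlinearity_diff_le) auto
    finally show "norm t3 \<le> cmod (Complex k \<nu>) * E * (Lp * norm (U - V))" .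
    have "norm (N V) \<le> Lp * norm V"
      using assms UV unfolding Lp_def N_def by (intro norm_power_nonlinearity_le) auto
    also have "\<dots> \<le> Lp * M"
      using nn UV by (intro mult_left_mono) auto
    finally have NV: "norm (N V) \<le> Lp * M" .
    have "norm t4 \<le> cmod (Complex k \<nu> * of_real (e - e')) * norm (N V)"
      unfolding t4_def by (rule norm_scaleC_ell2_le)
    also have "\<dots> \<le> cmod (Complex k \<nu>) * (E * (p * Z) * \<bar>a - a'\<bar>) * (Lp * M)"
      using de nn assms unfolding norm_mult norm_of_real
      by (intro mult_mono NV) auto
    finally show "norm t4 \<le> cmod (Complex k \<nu>) * (E * (p * Z) * \<bar>a - a'\<bar>) * (Lp * M)" .
    show "norm t5 \<le> exp (b * Z) * Z * \<bar>a - a'\<bar> * norm g"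
      unfolding t5_def norm_scaleR by (intro mult_right_mono dg) simp
    show "norm t6 \<le> b * Z * norm (U - V)"
      unfolding t6_def norm_scaleR by (intro mult_right_mono ax a) simp
    show "norm t7 \<le> Z * \<bar>a - a'\<bar> * M"
      unfolding t7_def norm_scaleR using assms by (intro mult_mono dx UV) auto
  qed
  also have "\<dots> = L * norm (U - V) + K * \<bar>a - a'\<bar>"
    by (simp add: L_def K_def algebra_simps)
  finally show "norm (lattice_rhs l \<mu> \<gamma> \<beta> k \<nu> p g a x U - lattice_rhs l \<mu> \<gamma> \<beta> k \<nu> p g a' x V)
      \<le> L * norm (U - V) + K * \<bar>a - a'\<bar>" .
qed

section \<open>Differential inequalities\<close>

text \<open>Variation of constants for \<open>f' \<le> c f + \<dots>\<close> with an integrating factor \<open>exp (- C)\<close>; the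
  contribution of the source term enters through an antiderivative \<open>G\<close> of an upper bound, which
  spares the evaluation of an integral.\<close>

lemma differential_inequality:
  fixes f C G :: "real \<Rightarrow> real"
  assumes "s \<le> t"
    and f: "\<And>\<tau>. \<tau> \<in> {s..t} \<Longrightarrow> (f has_real_derivative f' \<tau>) (at \<tau> within {s..t})"
    and C: "\<And>\<tau>. \<tau> \<in> {s..t} \<Longrightarrow> (C has_real_derivative c \<tau>) (at \<tau> within {s..t})"
    and G: "\<And>\<tau>. \<tau> \<in> {s..t} \<Longrightarrow> (G has_real_derivative G' \<tau>) (at \<tau> within {s..t})"
    and le: "\<And>\<tau>. \<tau> \<in> {s..t} \<Longrightarrow> exp (- C \<tau>) * (f' \<tau> - c \<tau> * f \<tau>) \<le> G' \<tau>"
  shows "exp (- C t) * f t \<le> exp (- C s) * f s + (G t - G s)"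
proof -
  define F where "F = (\<lambda>\<tau>. G \<tau> - exp (- C \<tau>) * f \<tau>)"
  define F' where "F' = (\<lambda>\<tau>. G' \<tau> - exp (- C \<tau>) * (f' \<tau> - c \<tau> * f \<tau>))"
  have F: "(F has_real_derivative F' \<tau>) (at \<tau> within {s..t})" if "\<tau> \<in> {s..t}" for \<tau>
    unfolding F_def F'_def
    by (rule derivative_eq_intros f C G that refl)+ (simp add: algebra_simps)
  have "F s \<le> F t"
  proof (rule DERIV_nonneg_imp_increasing_open[OF \<open>s \<le> t\<close>])
    show "continuous_on {s..t} F"
      using F by (rule DERIV_continuous_on)
    fix \<tau> assume "s < \<tau>" "\<tau> < t"
    then have \<tau>: "\<tau> \<in> {s..t}" "\<tau> \<in> interior {s..t}"
      by auto
    have "DERIV F \<tau> :> F' \<tau>"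
      using F[OF \<tau>(1)] unfolding at_within_interior[OF \<tau>(2)] .
    moreover have "0 \<le> F' \<tau>"
      using le[OF \<tau>(1)] unfolding F'_def by simp
    ultimately show "\<exists>y. DERIV F \<tau> :> y \<and> 0 \<le> y"
      by blast
  qed
  then show ?thesis
    by (simp add: F_def)
qed

lemma gronwall:
  fixes f :: "real \<Rightarrow> real"
  assumes "0 \<le> t" "0 \<le> c" "0 \<le> d"
    and f: "\<And>\<tau>. \<tau> \<in> {0..t} \<Longrightarrow> (f has_real_derivative f' \<tau>) (at \<tau> within {0..t})"
    and le: "\<And>\<tau>. \<tau> \<in> {0..t} \<Longrightarrow> f' \<tau> \<le> c * f \<tau> + d"
  shows "f t \<le> (f 0 + d * t) * exp (c * t)"
proof -
  have "exp (- (c * t)) * f t \<le> exp (- (c * 0)) * f 0 + (d * t - d * 0)"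
  proof (rule differential_inequality[where f' = f' and c = "\<lambda>_. c" and G' = "\<lambda>_. d"])
    fix \<tau> assume \<tau>: "\<tau> \<in> {0..t}"
    have "exp (- (c * \<tau>)) * (f' \<tau> - c * f \<tau>) \<le> exp (- (c * \<tau>)) * d"
      using le[OF \<tau>] by (intro mult_left_mono) auto
    also have "\<dots> \<le> 1 * d"
      using assms \<tau> by (intro mult_right_mono) auto
    finally show "exp (- (c * \<tau>)) * (f' \<tau> - c * f \<tau>) \<le> d"
      by simp
  qed (use assms in \<open>auto intro!: derivative_eq_intros\<close>)
  then have "exp (- (c * t)) * f t * exp (c * t) \<le> (f 0 + d * t) * exp (c * t)"
    by (intro mult_right_mono) auto
  moreover have "exp (- (c * t)) * f t * exp (c * t) = f t"
    by (simp add: exp_minus)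
  ultimately show ?thesis
    by simp
qed

lemma norm_sq_has_real_derivative:
  fixes \<phi> :: "real \<Rightarrow> 'a::real_inner"
  assumes "(\<phi> has_vector_derivative v) (at t within S)"
  shows "((\<lambda>t. (norm (\<phi> t))\<^sup>2) has_real_derivative 2 * inner (\<phi> t) v) (at t within S)"
  using bounded_bilinear.has_vector_derivative[OF bounded_bilinear_inner assms assms]
  by (simp add: power2_norm_eq_inner has_real_derivative_iff_has_vector_derivative inner_commute)

text \<open>The estimate is run for the square of the norm, which is differentiable also where the norm
  vanishes; the cross term \<open>2 \<eta> norm X\<close> is split by \<open>2 x y \<le> x\<^sup>2 + y\<^sup>2\<close>, which is where the extra
  \<open>1\<close> in the exponent comes from.\<close>

lemma norm_gronwall:
  fixes X :: "real \<Rightarrow> 'a::real_inner"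
  assumes "0 \<le> t" "0 \<le> L" "0 \<le> \<eta>"
    and X: "\<And>\<tau>. \<tau> \<in> {0..t} \<Longrightarrow> (X has_vector_derivative X' \<tau>) (at \<tau> within {0..t})"
    and le: "\<And>\<tau>. \<tau> \<in> {0..t} \<Longrightarrow> norm (X' \<tau>) \<le> L * norm (X \<tau>) + \<eta>"
  shows "norm (X t) \<le> (norm (X 0) + \<eta> * sqrt t) * sqrt (exp ((2 * L + 1) * t))"
proof -
  have "(norm (X t))\<^sup>2 \<le> ((norm (X 0))\<^sup>2 + \<eta>\<^sup>2 * t) * exp ((2 * L + 1) * t)"
  proof (rule gronwall)
    fix \<tau> assume \<tau>: "\<tau> \<in> {0..t}"
    show "((\<lambda>\<tau>. (norm (X \<tau>))\<^sup>2) has_real_derivative 2 * inner (X \<tau>) (X' \<tau>)) (at \<tau> within {0..t})"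
      by (intro norm_sq_has_real_derivative X \<tau>)
    have "inner (X \<tau>) (X' \<tau>) \<le> norm (X \<tau>) * norm (X' \<tau>)"
      by (rule norm_cauchy_schwarz)
    also have "\<dots> \<le> norm (X \<tau>) * (L * norm (X \<tau>) + \<eta>)"
      by (intro mult_left_mono le \<tau>) simp
    finally have "2 * inner (X \<tau>) (X' \<tau>) \<le> 2 * L * (norm (X \<tau>))\<^sup>2 + 2 * norm (X \<tau>) * \<eta>"
      by (simp add: power2_eq_square algebra_simps)
    also have "2 * norm (X \<tau>) * \<eta> \<le> (norm (X \<tau>))\<^sup>2 + \<eta>\<^sup>2"
      by (rule sum_squares_bound)
    finally show "2 * inner (X \<tau>) (X' \<tau>) \<le> (2 * L + 1) * (norm (X \<tau>))\<^sup>2 + \<eta>\<^sup>2"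
      by (simp add: algebra_simps)
  qed (use assms in auto)
  also have "\<dots> \<le> (norm (X 0) + \<eta> * sqrt t)\<^sup>2 * exp ((2 * L + 1) * t)"
    using assms by (intro mult_right_mono) (auto simp: power2_sum power_mult_distrib)
  also have "\<dots> = ((norm (X 0) + \<eta> * sqrt t) * sqrt (exp ((2 * L + 1) * t)))\<^sup>2"
    by (simp add: power_mult_distrib)
  finally show ?thesis
    by (rule power2_le_imp_le) (use assms in simp)
qed

lemma sublinear_at_bot_bound:
  fixes f :: "real \<Rightarrow> real"
  assumes "continuous_on UNIV f" "((\<lambda>t. \<bar>f t\<bar> / \<bar>t\<bar>) \<longlongrightarrow> 0) at_bot" "0 < e"
  obtains C where "0 \<le> C" "\<And>t. t \<le> 0 \<Longrightarrow> \<bar>f t\<bar> \<le> C + e * \<bar>t\<bar>"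
proof -
  have "\<forall>\<^sub>F t in at_bot. \<bar>f t\<bar> / \<bar>t\<bar> < e"
    using order_tendstoD(2)[OF assms(2,3)] .
  then obtain T where T: "\<And>t. t \<le> T \<Longrightarrow> \<bar>f t\<bar> / \<bar>t\<bar> < e"
    by (auto simp: eventually_at_bot_linorder)
  have "bounded (f ` {min T (-1)..0})"
    by (intro compact_imp_bounded compact_continuous_image continuous_on_subset[OF assms(1)]) auto
  then obtain C where "\<forall>y\<in>f ` {min T (-1)..0}. norm y \<le> C"
    unfolding bounded_iff by blast
  then have C: "\<bar>f t\<bar> \<le> C" if "t \<in> {min T (-1)..0}" for t
    using that by auto
  show ?thesis
  proof
    show "0 \<le> \<bar>C\<bar>" by simp
    fix t :: real assume "t \<le> 0"
    show "\<bar>f t\<bar> \<le> \<bar>C\<bar> + e * \<bar>t\<bar>"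
    proof (cases "t < min T (-1)")
      case True
      then have "\<bar>f t\<bar> / \<bar>t\<bar> < e" "0 < \<bar>t\<bar>"
        using T[of t] by simp_all
      then have "\<bar>f t\<bar> < e * \<bar>t\<bar>"
        by (simp only: pos_divide_less_eq)
      then show ?thesis by simp
    next
      case False
      then have "\<bar>f t\<bar> \<le> C" using C[of t] \<open>t \<le> 0\<close> by auto
      moreover have "0 \<le> e * \<bar>t\<bar>" using assms by simp
      ultimately show ?thesis by linarith
    qed
  qed
qed

section \<open>Paths of the noise\<close>

lemma shift_shift: "shift s (shift t \<omega>) = shift (t + s) \<omega>"
  by (simp add: shift_def add.assoc)

text \<open>A continuous path is determined by its values at rational times. Countable modifications of
  a random set are therefore measurable, so that a random set may be prescribed freely along a
  sequence of points of a single orbit.\<close>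

lemma singleton_in_sets_wiener:
  assumes P: "two_sided_wiener_measure P" and \<omega>: "\<omega> \<in> space P"
  shows "{\<omega>} \<in> sets P"
proof -
  have sp: "space P = wiener_paths"
    and dist: "\<And>s t. s < t \<Longrightarrow> distributed P lborel (\<lambda>\<omega>. \<omega> t - \<omega> s) (normal_density 0 (sqrt (t - s)))"
    using P by (auto simp: two_sided_wiener_measure_def)
  have incr: "(\<lambda>\<omega>. \<omega> t - \<omega> s) \<in> borel_measurable P" if "s < t" for s t
    using distributed_measurable[OF dist[OF that]] by simp
  have ev: "(\<lambda>\<omega>. \<omega> t) \<in> borel_measurable P" for t
  proof -
    consider "t < 0" | "t = 0" | "0 < t" by linarith
    then show ?thesis
    proof cases
      case 1
      have "(\<lambda>\<omega>. - (\<omega> 0 - \<omega> t)) \<in> borel_measurable P"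
        using incr[OF 1] by measurable
      then show ?thesis
        by (rule measurable_cong[THEN iffD1, rotated]) (simp add: sp wiener_paths_def)
    next
      case 2
      have "(\<lambda>\<omega>. 0 :: real) \<in> borel_measurable P"
        by simp
      then show ?thesis
        by (rule measurable_cong[THEN iffD1, rotated]) (simp add: sp wiener_paths_def 2)
    next
      case 3
      show ?thesis
        by (rule measurable_cong[THEN iffD1, OF _ incr[OF 3]]) (simp add: sp wiener_paths_def)
    qed
  qed
  have "{\<omega>} = {\<omega>' \<in> space P. \<forall>q\<in>\<rat>. \<omega>' q = \<omega> q}"
  proof (intro equalityI subsetI)
    fix \<omega>' assume "\<omega>' \<in> {\<omega>' \<in> space P. \<forall>q\<in>\<rat>. \<omega>' q = \<omega> q}"
    then have "continuous_on (closure \<rat>) (\<lambda>t. \<omega>' t - \<omega> t)" and "\<And>q. q \<in> \<rat> \<Longrightarrow> \<omega>' q - \<omega> q = 0"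
      using \<omega> by (auto simp: sp wiener_paths_def intro!: continuous_intros intro: continuous_on_subset)
    from continuous_constant_on_closure[OF this] have "\<omega>' t - \<omega> t = 0" for t
      by (simp add: Rats_closure_real)
    then show "\<omega>' \<in> {\<omega>}" by auto
  qed (use \<omega> in auto)
  also have "\<dots> \<in> sets P"
    by (intro sets.sets_Collect_countable_All' countable_rat borel_measurable_eq ev borel_measurable_const)
  finally show ?thesis .
qed

section \<open>Wave packets of small amplitude\<close>

text \<open>A bounded perturbation \<open>w\<close> whose entries are all tiny hardly changes the nonlinear term,
  wherever the state \<open>V\<close> is concentrated. The reason is the pointwise bound
  \<open>s powr p \<le> \<delta> + C s\<close> on bounded intervals: after multiplication by \<open>w\<close>, the first summand is
  small because \<open>\<delta>\<close> is, the second because \<open>w\<close> may be estimated in the supremum norm and \<open>V\<close> in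
  the \<open>ell2\<close> norm.\<close>

lemma power_nonlinearity_small_amplitude:
  assumes "0 < p" "0 \<le> M" "0 < \<epsilon>"
  obtains K where "0 \<le> K"
    and "\<And>V w \<sigma>. \<lbrakk>norm V \<le> M; norm w \<le> M; \<And>j. cmod (ell2_nth w j) \<le> \<sigma>\<rbrakk> \<Longrightarrow>
      norm (power_nonlinearity p (V + w) - power_nonlinearity p V) \<le> \<epsilon> + K * \<sigma>"
proof
  define \<delta> where "\<delta> = \<epsilon> / ((p + 1) * (M + 1))"
  define r where "r = \<delta> powr (1 / p)"
  define C where "C = (2 * M) powr p / r"
  have pos: "0 < \<delta>" "0 < r" "0 \<le> C" "r powr p = \<delta>"
    using assms by (simp_all add: \<delta>_def r_def C_def powr_powr)
  have powr_le: "s powr p \<le> \<delta> + C * s" if "0 \<le> s" "s \<le> 2 * M" for s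
  proof (cases "s \<le> r")
    case True
    then have "s powr p \<le> \<delta>"
      using that assms pos(4) powr_mono2[of p s r] by simp
    moreover have "0 \<le> C * s" using pos that by simp
    ultimately show ?thesis by linarith
  next
    case False
    have "s powr p \<le> (2 * M) powr p * 1"
      using that assms powr_mono2[of p s "2 * M"] by simp
    also have "\<dots> \<le> (2 * M) powr p * (s / r)"
      using False pos by (intro mult_left_mono) auto
    also have "\<dots> = C * s"
      by (simp add: C_def)
    finally show ?thesis using pos by linarith
  qed
  show "0 \<le> (p + 1) * C * (2 * M)"
    using assms pos by simp
  fix V w :: ell2 and \<sigma> :: real
  assume V: "norm V \<le> M" and w: "norm w \<le> M" and \<sigma>: "\<And>j. cmod (ell2_nth w j) \<le> \<sigma>"
  have "0 \<le> \<sigma>" using order_trans[OF norm_ge_zero \<sigma>] .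
  define N where "N = power_nonlinearity p"
  define v where "v = (\<lambda>j. cmod (ell2_nth V j) + cmod (ell2_nth w j))"
  \<comment> \<open>The sequence of pointwise bounds, as an element of \<open>ell2\<close> so that the triangle inequality
    applies to it.\<close>
  define Y where "Y = ((p + 1) * \<delta>) *\<^sub>R Abs_ell2 (\<lambda>j. of_real (cmod (ell2_nth w j)))
    + ((p + 1) * C * \<sigma>) *\<^sub>R (Abs_ell2 (\<lambda>j. of_real (cmod (ell2_nth V j)))
      + Abs_ell2 (\<lambda>j. of_real (cmod (ell2_nth w j))))"
  have abs_nth: "ell2_nth (Abs_ell2 (\<lambda>j. of_real (cmod (ell2_nth u j)))) j = of_real (cmod (ell2_nth u j))"
    for u j by (subst Abs_ell2_inverse) (simp_all add: ell2_summable)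
  have abs_norm: "norm (Abs_ell2 (\<lambda>j. of_real (cmod (ell2_nth u j)))) = norm u" for u
    by (simp add: norm_ell2_eq abs_nth)
  have "norm (N (V + w) - N V) \<le> 1 * norm Y"
  proof (rule norm_ell2_le_mult)
    fix j
    have v: "0 \<le> v j" "v j \<le> 2 * M"
      using cmod_ell2_nth_le_norm[of V j] cmod_ell2_nth_le_norm[of w j] V w by (auto simp: v_def)
    have "cmod (ell2_nth (N (V + w) - N V) j) \<le> (p + 1) * v j powr p * cmod (ell2_nth w j)"
      using norm_powr_mult_diff_le[of p "ell2_nth (V + w) j" "v j" "ell2_nth V j"] assms(1)
        norm_triangle_ineq[of "ell2_nth V j" "ell2_nth w j"]
      by (simp add: N_def minus_ell2.rep_eq plus_ell2.rep_eq ell2_nth_power_nonlinearity v_def)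
    also have "\<dots> \<le> (p + 1) * (\<delta> + C * v j) * cmod (ell2_nth w j)"
      using assms(1) powr_le[OF v] by (intro mult_right_mono mult_left_mono) auto
    also have "\<dots> = (p + 1) * \<delta> * cmod (ell2_nth w j) + (p + 1) * C * v j * cmod (ell2_nth w j)"
      by (simp add: algebra_simps)
    also have "\<dots> \<le> (p + 1) * \<delta> * cmod (ell2_nth w j) + (p + 1) * C * v j * \<sigma>"
      using assms(1) pos v \<sigma> by (intro add_left_mono mult_left_mono) auto
    also have "\<dots> = cmod (of_real ((p + 1) * \<delta> * cmod (ell2_nth w j) + (p + 1) * C * v j * \<sigma>))"
      using assms(1) pos v \<open>0 \<le> \<sigma>\<close> unfolding norm_of_real by simp
    also have "of_real ((p + 1) * \<delta> * cmod (ell2_nth w j) + (p + 1) * C * v j * \<sigma>) = ell2_nth Y j"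
      by (simp add: Y_def plus_ell2.rep_eq scaleR_ell2.rep_eq abs_nth scaleR_conv_of_real v_def algebra_simps)
    finally show "cmod (ell2_nth (N (V + w) - N V) j) \<le> 1 * cmod (ell2_nth Y j)"
      by simp
  qed simp
  also have "1 * norm Y \<le> (p + 1) * \<delta> * norm w + (p + 1) * C * \<sigma> * (norm V + norm w)"
  proof -
    have "norm Y \<le> norm (((p + 1) * \<delta>) *\<^sub>R Abs_ell2 (\<lambda>j. of_real (cmod (ell2_nth w j))))
      + norm (((p + 1) * C * \<sigma>) *\<^sub>R (Abs_ell2 (\<lambda>j. of_real (cmod (ell2_nth V j)))
      + Abs_ell2 (\<lambda>j. of_real (cmod (ell2_nth w j)))))"
      unfolding Y_def by (rule norm_triangle_ineq)
    also have "\<dots> \<le> (p + 1) * \<delta> * norm w + (p + 1) * C * \<sigma> * (norm V + norm w)"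
      using assms(1) pos \<open>0 \<le> \<sigma>\<close> unfolding norm_scaleR
      by (intro add_mono mult_mono order_trans[OF norm_triangle_ineq]) (simp_all add: abs_norm)
    finally show ?thesis by simp
  qed
  also have "\<dots> \<le> (p + 1) * \<delta> * (M + 1) + (p + 1) * C * \<sigma> * (2 * M)"
    using assms(1) pos \<open>0 \<le> \<sigma>\<close> V w by (intro add_mono mult_left_mono) auto
  also have "(p + 1) * \<delta> * (M + 1) = \<epsilon>"
    using assms by (simp add: \<delta>_def)
  finally show "norm (power_nonlinearity p (V + w) - power_nonlinearity p V) \<le> \<epsilon> + (p + 1) * C * (2 * M) * \<sigma>"
    by (simp add: N_def ac_simps)
qed

lemma norm_ell2_finite_support:
  assumes "finite F" "\<And>j. j \<notin> F \<Longrightarrow> ell2_nth u j = 0"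
  shows "norm u = sqrt (\<Sum>j\<in>F. (cmod (ell2_nth u j))\<^sup>2)"
proof -
  have "(\<Sum>\<^sub>\<infinity>j. (cmod (ell2_nth u j))\<^sup>2) = (\<Sum>\<^sub>\<infinity>j\<in>F. (cmod (ell2_nth u j))\<^sup>2)"
    using assms(2) by (intro infsum_cong_neutral) auto
  then show ?thesis
    using assms(1) by (simp add: norm_ell2_eq)
qed

text \<open>Approximate eigenvectors at the top \<open>4\<close> of the spectrum of the Laplacian, spread over so many
  sites that their entries are small. The witness is the alternating sequence
  \<open>1, -1, 1, \<dots>\<close> on \<open>N\<close> consecutive sites, divided by \<open>sqrt N\<close>: the eigenvalue equation fails
  only at the two ends.\<close>

lemma top_frequency_wave_packet:
  assumes "0 < \<epsilon>"
  obtains \<psi> where "norm \<psi> = 1" "\<And>j. cmod (ell2_nth \<psi> j) \<le> \<epsilon>"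
    "norm (lattice_Laplacian \<psi> - 4 *\<^sub>R \<psi>) \<le> \<epsilon>"
proof -
  obtain N :: nat where N: "(4 / \<epsilon>)\<^sup>2 < real N"
    using reals_Archimedean2 by blast
  then have N0: "0 < N"
    by (metis gr0I less_le_trans not_less of_nat_0 zero_le_power2)
  have sqrtN: "4 / \<epsilon> \<le> sqrt N"
    using N by (intro real_le_rsqrt) simp
  define f where "f = (\<lambda>j :: int. if j \<in> {0..<int N} then (if even j then 1 else - 1) else 0 :: complex)"
  define \<phi> where "\<phi> = Abs_ell2 f"
  have "(\<lambda>j. (cmod (f j))\<^sup>2) summable_on UNIV"
    using summable_on_finite[of "{0..<int N}" "\<lambda>j. (cmod (f j))\<^sup>2"]
    by (subst summable_on_cong_neutral[of "{0..<int N}"]) (auto simp: f_def)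
  then have \<phi>: "ell2_nth \<phi> = f"
    by (simp add: \<phi>_def Abs_ell2_inverse)
  have norm_\<phi>: "norm \<phi> = sqrt N"
  proof -
    have "(\<Sum>j\<in>{0..<int N}. (cmod (f j))\<^sup>2) = (\<Sum>j\<in>{0..<int N}. 1)"
      by (rule sum.cong) (auto simp: f_def)
    then show ?thesis
      by (subst norm_ell2_finite_support[of "{0..<int N}"]) (auto simp: \<phi> f_def)
  qed
  have jump: "ell2_nth (\<phi> + translate 1 \<phi>) j = f j + f (j + 1)" for j
    by (simp add: \<phi> plus_ell2.rep_eq translate.rep_eq)
  \<comment> \<open>Neighbouring entries cancel except at the two ends of the support.\<close>
  have "norm (\<phi> + translate 1 \<phi>) = sqrt (\<Sum>j\<in>{- 1, int N - 1}. (cmod (f j + f (j + 1)))\<^sup>2)"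
    by (subst norm_ell2_finite_support[of "{- 1, int N - 1}"]) (auto simp: jump f_def)
  also have "\<dots> \<le> sqrt (2\<^sup>2)"
    using N0 by (intro real_sqrt_le_mono) (auto simp: f_def)
  finally have jump_le: "norm (\<phi> + translate 1 \<phi>) \<le> 2"
    by simp
  have "translate (- 1) (\<phi> + translate 1 \<phi>) = \<phi> + translate (- 1) \<phi>"
    by (rule ell2_eqI) (simp add: plus_ell2.rep_eq translate.rep_eq)
  then have jump_le': "norm (\<phi> + translate (- 1) \<phi>) \<le> 2"
    using jump_le by (metis norm_translate)
  have "lattice_Laplacian \<phi> - 4 *\<^sub>R \<phi> = - (\<phi> + translate 1 \<phi>) - (\<phi> + translate (- 1) \<phi>)"
    by (rule ell2_eqI)
      (simp add: lattice_Laplacian_eq minus_ell2.rep_eq plus_ell2.rep_eq uminus_ell2.rep_eq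
        scaleR_ell2.rep_eq scaleR_conv_of_real)
  then have lap: "norm (lattice_Laplacian \<phi> - 4 *\<^sub>R \<phi>) \<le> 4"
    using jump_le jump_le' norm_triangle_ineq4[of "- (\<phi> + translate 1 \<phi>)" "\<phi> + translate (- 1) \<phi>"]
    by (simp only: norm_minus_cancel)
  define \<psi> where "\<psi> = (1 / sqrt N) *\<^sub>R \<phi>"
  have inv_le: "4 * (1 / sqrt N) \<le> \<epsilon>"
    using sqrtN assms N0 by (simp add: field_simps)
  show ?thesis
  proof
    show "norm \<psi> = 1"
      using N0 by (simp add: \<psi>_def norm_\<phi>)
    show "cmod (ell2_nth \<psi> j) \<le> \<epsilon>" for j
    proof -
      have "cmod (ell2_nth \<psi> j) = 1 / sqrt N * cmod (f j)"
        using N0 by (simp add: \<psi>_def scaleR_ell2.rep_eq \<phi> norm_divide)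
      also have "\<dots> \<le> 1 / sqrt N * 1"
        by (intro mult_left_mono) (auto simp: f_def)
      also have "\<dots> \<le> 4 * (1 / sqrt N)"
        using real_sqrt_ge_zero[of N] by (simp add: divide_right_mono)
      finally show ?thesis using inv_le by linarith
    qed
    have "lattice_Laplacian \<psi> - 4 *\<^sub>R \<psi> = (1 / sqrt N) *\<^sub>R (lattice_Laplacian \<phi> - 4 *\<^sub>R \<phi>)"
      by (rule ell2_eqI)
        (simp add: \<psi>_def lattice_Laplacian.rep_eq minus_ell2.rep_eq scaleR_ell2.rep_eq
          scaleR_conv_of_real algebra_simps)
    then have "norm (lattice_Laplacian \<psi> - 4 *\<^sub>R \<psi>) = 1 / sqrt N * norm (lattice_Laplacian \<phi> - 4 *\<^sub>R \<phi>)"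
      by simp
    also have "\<dots> \<le> 1 / sqrt N * 4"
      by (intro mult_left_mono lap) simp
    finally show "norm (lattice_Laplacian \<psi> - 4 *\<^sub>R \<psi>) \<le> \<epsilon>"
      using inv_le by linarith
  qed
qed

lemma semi_dist_lessE:
  assumes "semi_dist B C < ennreal r" "x \<in> B"
  obtains y where "y \<in> C" "norm (x - y) < r"
proof -
  have "(INF y\<in>C. ennreal (norm (x - y))) \<le> semi_dist B C"
    unfolding semi_dist_def using assms(2) by (rule SUP_upper)
  also note assms(1)
  finally show ?thesis
    using that by (auto simp: INF_less_iff ennreal_less_iff)
qed

section \<open>The family of random attractors\<close>

locale lattice_attractors =
  fixes l \<mu> \<gamma> \<beta> k \<nu> p :: real and g :: ell2
    and P :: "(real \<Rightarrow> real) measure" and \<Omega> :: "(real \<Rightarrow> real) set"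
    and \<Phi> :: "real \<Rightarrow> real \<Rightarrow> (real \<Rightarrow> real) \<Rightarrow> ell2 \<Rightarrow> ell2"
    and A :: "real \<Rightarrow> (real \<Rightarrow> real) \<Rightarrow> ell2 set"
  assumes pos: "0 < l" "0 < k" "0 < p" "4 * l < \<gamma>"
    and wiener: "two_sided_wiener_measure P"
    and admissible: "admissible_paths P \<Omega>"
    and generated: "\<And>a. 0 < a \<Longrightarrow> generated_by \<Omega> (lattice_rhs l \<mu> \<gamma> \<beta> k \<nu> p g a) (\<Phi> a)"
    and attractor: "\<And>a. 0 < a \<Longrightarrow> random_attractor P \<Omega> (\<Phi> a) (A a)"
begin

abbreviation z :: "(real \<Rightarrow> real) \<Rightarrow> real \<Rightarrow> real" where "z \<omega> t \<equiv> OU (shift t \<omega>)"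

definition Z :: "(real \<Rightarrow> real) \<Rightarrow> real \<Rightarrow> real" where "Z \<omega> t = (LBINT s=0..t. z \<omega> s)"

lemma shift_mem: "\<omega> \<in> \<Omega> \<Longrightarrow> shift t \<omega> \<in> \<Omega>"
  using admissible by (auto simp: admissible_paths_def)

lemma shift_0: "\<omega> \<in> \<Omega> \<Longrightarrow> shift 0 \<omega> = \<omega>"
  using admissible wiener sets.sets_into_space[of \<Omega> P]
  by (auto simp: admissible_paths_def two_sided_wiener_measure_def wiener_paths_def shift_def)

lemma continuous_z: "\<omega> \<in> \<Omega> \<Longrightarrow> continuous_on UNIV (z \<omega>)"
  using admissible by (auto simp: admissible_paths_def)

lemma Z_has_real_derivative:
  assumes "\<omega> \<in> \<Omega>"
  shows "(Z \<omega> has_real_derivative z \<omega> t) (at t)"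
proof -
  define r where "r = \<bar>t\<bar> + 1"
  have "((\<lambda>u. LBINT s=0..u. z \<omega> s) has_vector_derivative z \<omega> t) (at t within {- r..r})"
    using interval_integral_FTC2[of "- r" 0 r "z \<omega>" t]
      continuous_on_subset[OF continuous_z[OF assms]]
    by (simp add: r_def zero_ereal_def)
  moreover have "at t within {- r..r} = at t"
    by (rule at_within_interior) (auto simp: r_def)
  ultimately show ?thesis
    unfolding Z_def has_real_derivative_iff_has_vector_derivative by simp
qed

lemma Z_0: "Z \<omega> 0 = 0"
  by (simp add: Z_def flip: zero_ereal_def)

lemma continuous_Z: "\<omega> \<in> \<Omega> \<Longrightarrow> continuous_on S (Z \<omega>)"
  using Z_has_real_derivative by (meson DERIV_isCont continuous_at_imp_continuous_on)

text \<open>The two sides have the same derivative in \<open>t\<close> and agree at \<open>t = 0\<close>.\<close>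

lemma Z_shift:
  assumes "\<omega> \<in> \<Omega>"
  shows "Z (shift c \<omega>) t = Z \<omega> (c + t) - Z \<omega> c"
proof -
  have "((\<lambda>t. Z \<omega> (c + t) - Z (shift c \<omega>) t) has_real_derivative 0) (at t)" for t
  proof -
    have "((\<lambda>t. Z \<omega> (c + t)) has_real_derivative z \<omega> (c + t) * 1) (at t)"
      by (rule DERIV_chain2[OF Z_has_real_derivative[OF assms]]) (auto intro!: derivative_eq_intros)
    from DERIV_diff[OF this Z_has_real_derivative[OF shift_mem[OF assms], of c t]]
    show ?thesis
      by (simp add: shift_shift)
  qed
  then have "Z \<omega> (c + t) - Z (shift c \<omega>) t = Z \<omega> (c + 0) - Z (shift c \<omega>) 0"
    by (intro DERIV_isconst_all) auto
  then show ?thesis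
    by (simp add: Z_0)
qed

lemma noise_growth:
  assumes "\<omega> \<in> \<Omega>" "0 < e"
  obtains C where "0 \<le> C" "\<And>t. t \<le> 0 \<Longrightarrow> \<bar>z \<omega> t\<bar> \<le> C + e * \<bar>t\<bar>"
proof -
  have "((\<lambda>t. \<bar>z \<omega> t\<bar> / \<bar>t\<bar>) \<longlongrightarrow> 0) at_bot"
    using admissible assms(1) by (auto simp: admissible_paths_def)
  from sublinear_at_bot_bound[OF continuous_z[OF assms(1)] this assms(2)] that
  show ?thesis by blast
qed

lemma solution:
  assumes "0 < a" "\<omega> \<in> \<Omega>"
  shows "\<Phi> a 0 \<omega> y = y"
    and "\<tau> \<in> {0..t} \<Longrightarrow> ((\<lambda>t. \<Phi> a t \<omega> y) has_vector_derivative
      lattice_rhs l \<mu> \<gamma> \<beta> k \<nu> p g a (z \<omega> \<tau>) (\<Phi> a \<tau> \<omega> y)) (at \<tau> within {0..t})"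
proof -
  note gen = generated[OF assms(1), unfolded generated_by_def, rule_format, OF assms(2), of y]
  show "\<Phi> a 0 \<omega> y = y"
    using gen by blast
  show "((\<lambda>t. \<Phi> a t \<omega> y) has_vector_derivative
      lattice_rhs l \<mu> \<gamma> \<beta> k \<nu> p g a (z \<omega> \<tau>) (\<Phi> a \<tau> \<omega> y)) (at \<tau> within {0..t})"
    if "\<tau> \<in> {0..t}"
    using gen that by (auto intro: has_vector_derivative_within_subset)
qed

lemma noise_bounded:
  assumes "\<omega> \<in> \<Omega>"
  obtains B where "0 \<le> B" "\<And>\<tau>. \<tau> \<in> {0..t} \<Longrightarrow> \<bar>z \<omega> \<tau>\<bar> \<le> B"
proof -
  have "bounded (z \<omega> ` {0..t})"
    by (intro compact_imp_bounded compact_continuous_image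
      continuous_on_subset[OF continuous_z[OF assms]]) auto
  then obtain B where "\<forall>y\<in>z \<omega> ` {0..t}. norm y \<le> B"
    unfolding bounded_iff by blast
  then show ?thesis
    by (intro that[of "\<bar>B\<bar>"]) force+
qed

lemma solution_bounded:
  assumes \<omega>: "\<omega> \<in> \<Omega>" and b: "0 \<le> b" and R: "0 \<le> R"
  obtains M where "0 \<le> M"
    "\<And>a \<tau> y. \<lbrakk>0 < a; a \<le> b; norm y \<le> R; \<tau> \<in> {0..t}\<rbrakk> \<Longrightarrow> norm (\<Phi> a \<tau> \<omega> y) \<le> M"
proof -
  define d where "d = \<gamma> - 4 * l"
  have d: "0 < d" using pos by (simp add: d_def)
  obtain B where B: "0 \<le> B" "\<And>\<tau>. \<tau> \<in> {0..t} \<Longrightarrow> \<bar>z \<omega> \<tau>\<bar> \<le> B"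
    by (rule noise_bounded[OF \<omega>, of t]) blast
  define D where "D = exp (2 * (b * B)) * (norm g)\<^sup>2 / d"
  define M where "M = sqrt ((R\<^sup>2 + D * t) * exp (2 * (b * B) * t))"
  have D: "0 \<le> D" using d by (simp add: D_def)
  show ?thesis
  proof
    show "0 \<le> \<bar>M\<bar>" by simp
    fix a \<tau> and y :: ell2 assume a: "0 < a" "a \<le> b" and y: "norm y \<le> R" and \<tau>: "\<tau> \<in> {0..t}"
    have "(norm (\<Phi> a \<tau> \<omega> y))\<^sup>2 \<le> ((norm (\<Phi> a 0 \<omega> y))\<^sup>2 + D * \<tau>) * exp (2 * (b * B) * \<tau>)"
    proof (rule gronwall)
      show "0 \<le> \<tau>" "0 \<le> 2 * (b * B)" using \<tau> b B by auto
      show "0 \<le> D" by (rule D)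
      fix s assume s: "s \<in> {0..\<tau>}"
      show "((\<lambda>s. (norm (\<Phi> a s \<omega> y))\<^sup>2) has_real_derivative
          2 * inner (\<Phi> a s \<omega> y) (lattice_rhs l \<mu> \<gamma> \<beta> k \<nu> p g a (z \<omega> s) (\<Phi> a s \<omega> y)))
          (at s within {0..\<tau>})"
        by (intro norm_sq_has_real_derivative solution a \<omega> s)
      have "\<bar>a * z \<omega> s\<bar> \<le> b * B"
        unfolding abs_mult using a B(2)[of s] s \<tau> by (intro mult_mono) auto
      then have az: "2 * a * z \<omega> s \<le> 2 * (b * B)" "- 2 * a * z \<omega> s \<le> 2 * (b * B)"
        by linarith+
      have "2 * inner (\<Phi> a s \<omega> y) (lattice_rhs l \<mu> \<gamma> \<beta> k \<nu> p g a (z \<omega> s) (\<Phi> a s \<omega> y))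
          \<le> (2 * a * z \<omega> s - d) * (norm (\<Phi> a s \<omega> y))\<^sup>2 + exp (- 2 * a * z \<omega> s) * (norm g)\<^sup>2 / d"
        unfolding d_def by (rule lattice_rhs_dissipative[OF pos])
      also have "\<dots> \<le> 2 * (b * B) * (norm (\<Phi> a s \<omega> y))\<^sup>2 + D"
        unfolding D_def using az d by (intro add_mono mult_right_mono divide_right_mono) auto
      finally show "2 * inner (\<Phi> a s \<omega> y) (lattice_rhs l \<mu> \<gamma> \<beta> k \<nu> p g a (z \<omega> s) (\<Phi> a s \<omega> y))
          \<le> 2 * (b * B) * (norm (\<Phi> a s \<omega> y))\<^sup>2 + D" .
    qed
    also have "\<dots> \<le> (R\<^sup>2 + D * t) * exp (2 * (b * B) * t)"
    proof (rule mult_mono)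
      have "(norm (\<Phi> a 0 \<omega> y))\<^sup>2 \<le> R\<^sup>2"
        unfolding solution(1)[OF a(1) \<omega>] using y by (intro power_mono) auto
      moreover have "D * \<tau> \<le> D * t"
        using \<tau> D by (intro mult_left_mono) auto
      ultimately show "(norm (\<Phi> a 0 \<omega> y))\<^sup>2 + D * \<tau> \<le> R\<^sup>2 + D * t"
        by (rule add_mono)
      show "exp (2 * (b * B) * \<tau>) \<le> exp (2 * (b * B) * t)"
        unfolding exp_le_cancel_iff using \<tau> b B(1) by (intro mult_left_mono) auto
      show "0 \<le> R\<^sup>2 + D * t"
        using \<tau> D by auto
    qed simp
    finally show "norm (\<Phi> a \<tau> \<omega> y) \<le> \<bar>M\<bar>"
      unfolding M_def by (intro order_trans[OF real_le_rsqrt abs_ge_self])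
  qed
qed

section \<open>Growth of the noise, read off from the attractors\<close>

text \<open>The energy rate \<open>a z - (\<gamma> - 4 l)\<close> is attained. Perturb the solution \<open>V\<close> that starts
  at \<open>0\<close> by a wave packet \<open>\<psi>\<close> of norm \<open>1\<close> at the top frequency. Because \<open>\<psi>\<close> is spread thin, the
  nonlinear term is invisible to it, and \<open>V + c(t) \<psi>\<close> solves the equation up to a small error, where
  \<open>c\<close> solves the scalar linear equation \<open>c' = \<kappa> c\<close> with
  \<open>\<kappa> = 4 (l + \<i> \<mu>) - (\<gamma> + \<i> \<beta>) + a z\<close>.\<close>

lemma instability:
  assumes \<omega>: "\<omega> \<in> \<Omega>" and a: "0 < a" and t: "0 \<le> t" and \<epsilon>: "0 < \<epsilon>"
  obtains y where "norm y \<le> 1"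
    "exp (a * Z \<omega> t - (\<gamma> - 4 * l) * t) \<le> norm (\<Phi> a t \<omega> y - \<Phi> a t \<omega> 0) + \<epsilon>"
proof -
  define f where "f = lattice_rhs l \<mu> \<gamma> \<beta> k \<nu> p g a"
  define N where "N = power_nonlinearity p"
  define c where "c = (\<lambda>\<tau>. exp (Complex (a * Z \<omega> \<tau> - (\<gamma> - 4 * l) * \<tau>) ((4 * \<mu> - \<beta>) * \<tau>)))"
  define \<kappa> where "\<kappa> = (\<lambda>\<tau>. Complex (a * z \<omega> \<tau> - (\<gamma> - 4 * l)) (4 * \<mu> - \<beta>))"
  have c_deriv: "(c has_vector_derivative \<kappa> \<tau> * c \<tau>) (at \<tau> within S)" for \<tau> S
  proof -
    have "((\<lambda>\<tau>. a * Z \<omega> \<tau> - (\<gamma> - 4 * l) * \<tau>) has_real_derivative a * z \<omega> \<tau> - (\<gamma> - 4 * l)) (at \<tau> within S)"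
      by (auto intro!: derivative_eq_intros DERIV_subset[OF Z_has_real_derivative[OF \<omega>]])
    moreover have "((\<lambda>\<tau>. (4 * \<mu> - \<beta>) * \<tau>) has_real_derivative 4 * \<mu> - \<beta>) (at \<tau> within S)"
      by (auto intro!: derivative_eq_intros)
    ultimately have "((\<lambda>\<tau>. Complex (a * Z \<omega> \<tau> - (\<gamma> - 4 * l) * \<tau>) ((4 * \<mu> - \<beta>) * \<tau>))
        has_vector_derivative \<kappa> \<tau>) (at \<tau> within S)"
      unfolding \<kappa>_def Complex_eq
      by (intro has_vector_derivative_add has_vector_derivative_mult_right has_vector_derivative_of_real)
    from field_vector_diff_chain_within[OF this has_field_derivative_at_within[OF DERIV_exp]]
    show ?thesis
      by (simp add: c_def o_def)
  qed
  have cmod_c: "cmod (c \<tau>) = exp (a * Z \<omega> \<tau> - (\<gamma> - 4 * l) * \<tau>)" for \<tau>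
    by (simp add: c_def)
  have "bounded (c ` {0..t})"
    using c_deriv
    by (intro compact_imp_bounded compact_continuous_image)
      (auto intro!: has_vector_derivative_continuous simp: continuous_on_eq_continuous_within)
  then obtain Mc where "\<forall>x\<in>c ` {0..t}. norm x \<le> Mc"
    unfolding bounded_iff by blast
  then have Mc: "cmod (c \<tau>) \<le> Mc" if "\<tau> \<in> {0..t}" for \<tau>
    using that by auto
  have Mc0: "0 \<le> Mc" using order_trans[OF norm_ge_zero Mc[of 0]] t by simp
  obtain B where B: "0 \<le> B" "\<And>\<tau>. \<tau> \<in> {0..t} \<Longrightarrow> \<bar>z \<omega> \<tau>\<bar> \<le> B"
    by (rule noise_bounded[OF \<omega>, of t]) blast
  obtain M0 where M0: "0 \<le> M0"
    "\<And>a' \<tau> y. \<lbrakk>0 < a'; a' \<le> a; norm y \<le> 1; \<tau> \<in> {0..t}\<rbrakk> \<Longrightarrow> norm (\<Phi> a' \<tau> \<omega> y) \<le> M0"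
    by (rule solution_bounded[OF \<omega> less_imp_le[OF a] zero_le_one, of t]) blast
  define M where "M = M0 + Mc"
  have M: "0 \<le> M" "M0 \<le> M" "Mc \<le> M" using M0(1) Mc0 by (simp_all add: M_def)
  obtain L K0 where L: "0 \<le> L" "0 \<le> K0"
    and lip: "\<And>a1 a2 x U V. \<lbrakk>0 \<le> a1; a1 \<le> a; 0 \<le> a2; a2 \<le> a; \<bar>x\<bar> \<le> B; norm U \<le> M; norm V \<le> M\<rbrakk> \<Longrightarrow>
      norm (lattice_rhs l \<mu> \<gamma> \<beta> k \<nu> p g a1 x U - lattice_rhs l \<mu> \<gamma> \<beta> k \<nu> p g a2 x V)
        \<le> L * norm (U - V) + K0 * \<bar>a1 - a2\<bar>"
    by (rule lattice_rhs_lipschitz[OF pos(3) less_imp_le[OF a] M(1) B(1)]) blast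
  define E where "E = cmod (Complex k \<nu>) * exp (p * (a * B))"
  have E: "0 \<le> E" by (simp add: E_def)
  define S where "S = sqrt (t * exp ((2 * L + 1) * t)) + 1"
  have S: "0 < S" using t by (simp add: S_def add_nonneg_pos)
  \<comment> \<open>\<open>S\<close> is the amplification by Gronwall's inequality. The tolerance \<open>\<epsilon>1\<close> has to be chosen first, since the
    constant \<open>K\<close>, and with it the tolerance \<open>\<epsilon>2\<close> for the wave packet, depends on it.\<close>
  define \<epsilon>1 where "\<epsilon>1 = \<epsilon> / (2 * S * (E + 1))"
  have \<epsilon>1: "0 < \<epsilon>1" using \<epsilon> S E by (simp add: \<epsilon>1_def)
  obtain K where K: "0 \<le> K"
    "\<And>V w \<sigma>. \<lbrakk>norm V \<le> M; norm w \<le> M; \<And>j. cmod (ell2_nth w j) \<le> \<sigma>\<rbrakk> \<Longrightarrow>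
      norm (power_nonlinearity p (V + w) - power_nonlinearity p V) \<le> \<epsilon>1 + K * \<sigma>"
    by (rule power_nonlinearity_small_amplitude[OF pos(3) M(1) \<epsilon>1]) blast
  define Q where "Q = cmod (Complex l \<mu>) * Mc + E * (K * Mc)"
  have Q: "0 \<le> Q" using Mc0 E K by (simp add: Q_def)
  define \<epsilon>2 where "\<epsilon>2 = \<epsilon> / (2 * S * (Q + 1))"
  have \<epsilon>2: "0 < \<epsilon>2" using \<epsilon> S Q by (simp add: \<epsilon>2_def)
  obtain \<psi> where \<psi>: "norm \<psi> = 1" "\<And>j. cmod (ell2_nth \<psi> j) \<le> \<epsilon>2"
    "norm (lattice_Laplacian \<psi> - 4 *\<^sub>R \<psi>) \<le> \<epsilon>2"
    by (rule top_frequency_wave_packet[OF \<epsilon>2]) blast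
  define U where "U = (\<lambda>\<tau>. \<Phi> a \<tau> \<omega> \<psi>)"
  define V where "V = (\<lambda>\<tau>. \<Phi> a \<tau> \<omega> 0)"
  define w where "w = (\<lambda>\<tau>. c \<tau> *\<^sub>C \<psi>)"
  \<comment> \<open>\<open>X\<close> is the deviation of the true solution from the approximate one; \<open>\<eta>\<close> bounds the residual of
    the latter.\<close>
  define X where "X = (\<lambda>\<tau>. U \<tau> - V \<tau> - w \<tau>)"
  define X' where "X' = (\<lambda>\<tau>. f (z \<omega> \<tau>) (U \<tau>) - f (z \<omega> \<tau>) (V \<tau>) - (\<kappa> \<tau> * c \<tau>) *\<^sub>C \<psi>)"
  define \<eta> where "\<eta> = Q * \<epsilon>2 + E * \<epsilon>1"
  have \<eta>: "0 \<le> \<eta>" using Q \<epsilon>1 \<epsilon>2 E by (simp add: \<eta>_def)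
  have norm_w: "norm (w \<tau>) \<le> Mc" if "\<tau> \<in> {0..t}" for \<tau>
    using norm_scaleC_ell2_le[of "c \<tau>" \<psi>] Mc[OF that] \<psi>(1) by (simp add: w_def)
  have norm_U: "norm (U \<tau>) \<le> M0" if "\<tau> \<in> {0..t}" for \<tau>
    unfolding U_def using a \<psi>(1) that by (intro M0(2)) auto
  have norm_V: "norm (V \<tau>) \<le> M0" if "\<tau> \<in> {0..t}" for \<tau>
    unfolding V_def using a that by (intro M0(2)) auto
  have norm_X': "norm (X' \<tau>) \<le> L * norm (X \<tau>) + \<eta>" if \<tau>: "\<tau> \<in> {0..t}" for \<tau>
  proof -
    define s where "s = Complex k \<nu> * of_real (exp (p * a * z \<omega> \<tau>))"
    \<comment> \<open>The choice of \<open>\<kappa>\<close> cancels all linear terms except the defect of \<open>\<psi>\<close> as an eigenvector.\<close>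
    have residual: "f (z \<omega> \<tau>) (V \<tau> + w \<tau>) - f (z \<omega> \<tau>) (V \<tau>) - (\<kappa> \<tau> * c \<tau>) *\<^sub>C \<psi>
      = (Complex l \<mu> * c \<tau>) *\<^sub>C (lattice_Laplacian \<psi> - 4 *\<^sub>R \<psi>) - s *\<^sub>C (N (V \<tau> + w \<tau>) - N (V \<tau>))"
    proof (rule ell2_eqI)
      fix j
      have \<kappa>: "\<kappa> \<tau> = 4 * Complex l \<mu> - Complex \<gamma> \<beta> + of_real (a * z \<omega> \<tau>)"
        by (simp add: \<kappa>_def complex_eq_iff)
      show "ell2_nth (f (z \<omega> \<tau>) (V \<tau> + w \<tau>) - f (z \<omega> \<tau>) (V \<tau>) - (\<kappa> \<tau> * c \<tau>) *\<^sub>C \<psi>) j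
        = ell2_nth ((Complex l \<mu> * c \<tau>) *\<^sub>C (lattice_Laplacian \<psi> - 4 *\<^sub>R \<psi>)
          - s *\<^sub>C (N (V \<tau> + w \<tau>) - N (V \<tau>))) j"
        unfolding \<kappa> f_def lattice_rhs_def s_def[symmetric] N_def[symmetric]
        by (simp add: w_def lattice_Laplacian.rep_eq minus_ell2.rep_eq plus_ell2.rep_eq
            scaleR_ell2.rep_eq scaleC_ell2.rep_eq scaleR_conv_of_real algebra_simps)
    qed
    have "norm ((Complex l \<mu> * c \<tau>) *\<^sub>C (lattice_Laplacian \<psi> - 4 *\<^sub>R \<psi>)) \<le> cmod (Complex l \<mu>) * Mc * \<epsilon>2"
      unfolding norm_mult[symmetric] using Mc[OF \<tau>] \<psi>(3) Mc0
      by (intro order_trans[OF norm_scaleC_ell2_le]) (auto simp: norm_mult intro!: mult_mono)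
    moreover have "norm (s *\<^sub>C (N (V \<tau> + w \<tau>) - N (V \<tau>))) \<le> E * (\<epsilon>1 + K * (Mc * \<epsilon>2))"
    proof (intro order_trans[OF norm_scaleC_ell2_le] mult_mono)
      have "\<bar>a * z \<omega> \<tau>\<bar> \<le> a * B"
        using a B(2)[OF \<tau>] by (simp add: abs_mult)
      then have "a * z \<omega> \<tau> \<le> a * B"
        by linarith
      then have "p * (a * z \<omega> \<tau>) \<le> p * (a * B)"
        using pos(3) by (simp only: mult_le_cancel_left_pos)
      then show "cmod s \<le> E"
        unfolding s_def E_def norm_mult by (intro mult_left_mono) (simp_all add: mult.assoc)
      show "norm (N (V \<tau> + w \<tau>) - N (V \<tau>)) \<le> \<epsilon>1 + K * (Mc * \<epsilon>2)"
        unfolding N_def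
      proof (rule K(2))
        show "norm (V \<tau>) \<le> M" "norm (w \<tau>) \<le> M"
          using norm_V[OF \<tau>] norm_w[OF \<tau>] M by linarith+
        show "cmod (ell2_nth (w \<tau>) j) \<le> Mc * \<epsilon>2" for j
          unfolding w_def scaleC_ell2.rep_eq norm_mult
          using Mc[OF \<tau>] \<psi>(2) Mc0 by (intro mult_mono) auto
      qed
    qed (use E in auto)
    ultimately have "norm ((Complex l \<mu> * c \<tau>) *\<^sub>C (lattice_Laplacian \<psi> - 4 *\<^sub>R \<psi>)
        - s *\<^sub>C (N (V \<tau> + w \<tau>) - N (V \<tau>))) \<le> cmod (Complex l \<mu>) * Mc * \<epsilon>2 + E * (\<epsilon>1 + K * (Mc * \<epsilon>2))"
      by (intro order_trans[OF norm_triangle_ineq4]) (rule add_mono)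
    also have "\<dots> = \<eta>"
      by (simp add: \<eta>_def Q_def algebra_simps)
    finally have "norm (f (z \<omega> \<tau>) (V \<tau> + w \<tau>) - f (z \<omega> \<tau>) (V \<tau>) - (\<kappa> \<tau> * c \<tau>) *\<^sub>C \<psi>) \<le> \<eta>"
      by (simp only: residual)
    moreover have "norm (f (z \<omega> \<tau>) (U \<tau>) - f (z \<omega> \<tau>) (V \<tau> + w \<tau>)) \<le> L * norm (U \<tau> - (V \<tau> + w \<tau>)) + K0 * \<bar>a - a\<bar>"
      unfolding f_def
    proof (rule lip)
      show "norm (V \<tau> + w \<tau>) \<le> M"
        using norm_triangle_ineq[of "V \<tau>" "w \<tau>"] norm_V[OF \<tau>] norm_w[OF \<tau>] unfolding M_def by linarith
    qed (use a B(2)[OF \<tau>] norm_U[OF \<tau>] M in auto)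
    moreover have "X' \<tau> = (f (z \<omega> \<tau>) (U \<tau>) - f (z \<omega> \<tau>) (V \<tau> + w \<tau>))
        + (f (z \<omega> \<tau>) (V \<tau> + w \<tau>) - f (z \<omega> \<tau>) (V \<tau>) - (\<kappa> \<tau> * c \<tau>) *\<^sub>C \<psi>)"
      by (simp add: X'_def)
    moreover have "U \<tau> - (V \<tau> + w \<tau>) = X \<tau>"
      by (simp add: X_def)
    ultimately show ?thesis
      using norm_triangle_ineq[of "f (z \<omega> \<tau>) (U \<tau>) - f (z \<omega> \<tau>) (V \<tau> + w \<tau>)"
        "f (z \<omega> \<tau>) (V \<tau> + w \<tau>) - f (z \<omega> \<tau>) (V \<tau>) - (\<kappa> \<tau> * c \<tau>) *\<^sub>C \<psi>"] by simp
  qed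
  have "norm (X t) \<le> (norm (X 0) + \<eta> * sqrt t) * sqrt (exp ((2 * L + 1) * t))"
  proof (rule norm_gronwall[OF t L(1) \<eta> _ norm_X'])
    fix \<tau> assume \<tau>: "\<tau> \<in> {0..t}"
    show "(X has_vector_derivative X' \<tau>) (at \<tau> within {0..t})"
      unfolding X_def X'_def U_def V_def w_def f_def
      by (intro has_vector_derivative_diff solution a \<omega> \<tau>
          bounded_linear.has_vector_derivative[OF bounded_linear_scaleC_ell2_left] c_deriv)
  qed
  also have "X 0 = 0"
  proof -
    have "c 0 = 1" by (simp add: c_def Z_0 flip: zero_complex.code)
    moreover have "1 *\<^sub>C \<psi> = \<psi>" by (rule ell2_eqI) (simp add: scaleC_ell2.rep_eq)
    ultimately show ?thesis
      by (simp add: X_def U_def V_def w_def solution(1)[OF a \<omega>])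
  qed
  also have "(norm (0 :: ell2) + \<eta> * sqrt t) * sqrt (exp ((2 * L + 1) * t)) \<le> \<eta> * S"
    using \<eta> by (simp add: S_def real_sqrt_mult algebra_simps)
  also have "\<eta> * S \<le> \<epsilon>"
  proof -
    have half: "q * (\<epsilon> / (2 * S * (q + 1))) * S \<le> \<epsilon> / 2" if "0 \<le> q" for q
    proof -
      have cancel: "u * (\<epsilon> / (2 * S * u)) * S = \<epsilon> / 2" if "u \<noteq> 0" for u
        using S that by (simp add: field_simps)
      have "q * (\<epsilon> / (2 * S * (q + 1))) * S \<le> (q + 1) * (\<epsilon> / (2 * S * (q + 1))) * S"
        using \<epsilon> S that by (intro mult_right_mono) auto
      also have "\<dots> = \<epsilon> / 2"
        using that by (intro cancel) simp
      finally show ?thesis .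
    qed
    have "Q * \<epsilon>2 * S \<le> \<epsilon> / 2" "E * \<epsilon>1 * S \<le> \<epsilon> / 2"
      unfolding \<epsilon>1_def \<epsilon>2_def by (rule half[OF Q], rule half[OF E])
    then show ?thesis
      unfolding \<eta>_def distrib_right by linarith
  qed
  finally have X_le: "norm (X t) \<le> \<epsilon>" .
  have "norm (w t) = exp (a * Z \<omega> t - (\<gamma> - 4 * l) * t)"
  proof -
    have "norm (w t) = cmod (c t) * norm \<psi>"
      unfolding w_def by (rule norm_scaleC_ell2)
    then show ?thesis by (simp add: \<psi>(1) cmod_c)
  qed
  moreover have "norm (w t) \<le> norm (U t - V t) + norm (X t)"
    using norm_triangle_ineq4[of "U t - V t" "X t"] by (simp add: X_def)
  ultimately show ?thesis
    using X_le \<psi>(1) by (intro that[of \<psi>]) (auto simp: U_def V_def)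
qed

lemma attractor_invariant:
  assumes "0 < a" "\<omega> \<in> \<Omega>" "0 \<le> t"
  shows "\<Phi> a t \<omega> ` A a \<omega> = A a (shift t \<omega>)"
  using attractor[OF assms(1)] assms(2,3) by (auto simp: random_attractor_def)

lemma attractor_attracts:
  assumes "0 < a" "\<omega> \<in> \<Omega>" "D \<in> tempered_universe P \<Omega>"
  shows "((\<lambda>t. semi_dist (\<Phi> a t (shift (- t) \<omega>) ` D (shift (- t) \<omega>)) (A a \<omega>)) \<longlongrightarrow> 0) at_top"
  using attractor[OF assms(1)] assms(2,3) by (simp add: random_attractor_def)

lemma attractor_growth:
  assumes "0 < a" "\<omega> \<in> \<Omega>" "0 < \<rho>"
  shows "\<forall>\<^sub>F T in at_top. \<forall>y\<in>A a (shift (- T) \<omega>). norm y \<le> exp (\<rho> * T)"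
proof -
  have "tempered \<Omega> (A a)"
    using attractor[OF assms(1)] by (simp add: random_attractor_def tempered_universe_def)
  then have "((\<lambda>t. ennreal (exp (- \<rho> * t)) * (SUP y\<in>A a (shift (- t) \<omega>). ennreal (norm y))) \<longlongrightarrow> 0) at_top"
    using assms by (simp add: tempered_def)
  then have "\<forall>\<^sub>F t in at_top. ennreal (exp (- \<rho> * t)) * (SUP y\<in>A a (shift (- t) \<omega>). ennreal (norm y)) < 1"
    by (rule order_tendstoD) simp
  then show ?thesis
  proof eventually_elim
    fix T assume le: "ennreal (exp (- \<rho> * T)) * (SUP y\<in>A a (shift (- T) \<omega>). ennreal (norm y)) < 1"
    show "\<forall>y\<in>A a (shift (- T) \<omega>). norm y \<le> exp (\<rho> * T)"
    proof
      fix y assume y: "y \<in> A a (shift (- T) \<omega>)"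
      have "ennreal (exp (- \<rho> * T) * norm y) = ennreal (exp (- \<rho> * T)) * ennreal (norm y)"
        by (simp add: ennreal_mult)
      also have "\<dots> \<le> ennreal (exp (- \<rho> * T)) * (SUP y\<in>A a (shift (- T) \<omega>). ennreal (norm y))"
        by (intro mult_left_mono SUP_upper y) simp
      also have "\<dots> \<le> ennreal 1"
        using le by simp
      finally have "exp (- \<rho> * T) * norm y \<le> 1"
        by (subst (asm) ennreal_le_iff) simp_all
      then show "norm y \<le> exp (\<rho> * T)"
        by (simp add: exp_minus field_simps)
    qed
  qed
qed

text \<open>Solutions starting in the unit ball are attracted by a compact set, so their mutual distances
  stay bounded when they are started at \<open>- t\<close> and observed at time \<open>0\<close>. By \<open>instability\<close>, some
  of these distances are, up to an additive constant, as large as \<open>exp (- a Z(- t) - (\<gamma> - 4 l) t)\<close>.\<close>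

lemma attractor_forces_decay:
  assumes \<omega>: "\<omega> \<in> \<Omega>" and a: "0 < a"
  obtains C where "\<forall>\<^sub>F t in at_top. exp (- a * Z \<omega> (- t) - (\<gamma> - 4 * l) * t) \<le> C"
proof -
  have "(\<lambda>_. cball 0 1) \<in> tempered_universe P \<Omega>"
  proof -
    have "((\<lambda>t. ennreal (exp (- \<rho> * t)) * (SUP \<phi>\<in>cball 0 1. ennreal (norm (\<phi> :: ell2)))) \<longlongrightarrow> 0) at_top"
      if "0 < \<rho>" for \<rho> :: real
    proof (rule tendsto_sandwich[OF _ _ tendsto_const])
      show "\<forall>\<^sub>F t in at_top. ennreal (exp (- \<rho> * t)) * (SUP \<phi>\<in>cball 0 1. ennreal (norm (\<phi> :: ell2)))
          \<le> ennreal (exp (- \<rho> * t))"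
      proof (intro always_eventually allI)
        fix t
        have "ennreal (exp (- \<rho> * t)) * (SUP \<phi>\<in>cball 0 1. ennreal (norm (\<phi> :: ell2)))
            \<le> ennreal (exp (- \<rho> * t)) * 1"
          by (intro mult_left_mono SUP_least) auto
        then show "ennreal (exp (- \<rho> * t)) * (SUP \<phi>\<in>cball 0 1. ennreal (norm (\<phi> :: ell2)))
            \<le> ennreal (exp (- \<rho> * t))"
          by simp
      qed
      have "((\<lambda>t. exp (- \<rho> * t)) \<longlongrightarrow> 0) at_top"
        using that by real_asymp
      then show "((\<lambda>t. ennreal (exp (- \<rho> * t))) \<longlongrightarrow> 0) at_top"
        using tendsto_ennrealI by fastforce
    qed auto
    then show ?thesis
      by (auto simp: tempered_universe_def tempered_def closed_random_set_def)
  qed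
  from attractor_attracts[OF a \<omega> this]
  have ev: "\<forall>\<^sub>F t in at_top. semi_dist (\<Phi> a t (shift (- t) \<omega>) ` cball 0 1) (A a \<omega>) < 1"
    by (rule order_tendstoD) simp
  have "compact (A a \<omega>)"
    using attractor[OF a] \<omega> by (simp add: random_attractor_def)
  then obtain R where R: "\<And>w. w \<in> A a \<omega> \<Longrightarrow> norm w \<le> R"
    using compact_imp_bounded bounded_iff by metis
  have "\<forall>\<^sub>F t in at_top. exp (- a * Z \<omega> (- t) - (\<gamma> - 4 * l) * t) \<le> 2 * (R + 1) + 1"
    using ev eventually_ge_at_top[of 0]
  proof eventually_elim
    fix t :: real
    assume sd: "semi_dist (\<Phi> a t (shift (- t) \<omega>) ` cball 0 1) (A a \<omega>) < 1" and t: "0 \<le> t"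
    have bd: "norm (\<Phi> a t (shift (- t) \<omega>) y) \<le> R + 1" if "norm y \<le> 1" for y
    proof -
      have "\<Phi> a t (shift (- t) \<omega>) y \<in> \<Phi> a t (shift (- t) \<omega>) ` cball 0 1"
        using that by (intro imageI) simp
      then obtain w where w: "w \<in> A a \<omega>" "norm (\<Phi> a t (shift (- t) \<omega>) y - w) < 1"
        by (rule semi_dist_lessE[OF sd[folded ennreal_1]])
      then show ?thesis
        using R[OF w(1)] norm_triangle_sub[of "\<Phi> a t (shift (- t) \<omega>) y" w] by linarith
    qed
    obtain y where y: "norm y \<le> 1" "exp (a * Z (shift (- t) \<omega>) t - (\<gamma> - 4 * l) * t)
        \<le> norm (\<Phi> a t (shift (- t) \<omega>) y - \<Phi> a t (shift (- t) \<omega>) 0) + 1"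
      by (rule instability[OF shift_mem[OF \<omega>] a t zero_less_one])
    have "norm (\<Phi> a t (shift (- t) \<omega>) y - \<Phi> a t (shift (- t) \<omega>) 0) \<le> (R + 1) + (R + 1)"
      by (intro order_trans[OF norm_triangle_ineq4] add_mono bd y) simp
    with y(2) show "exp (- a * Z \<omega> (- t) - (\<gamma> - 4 * l) * t) \<le> 2 * (R + 1) + 1"
      by (simp add: Z_shift[OF \<omega>] Z_0)
  qed
  then show ?thesis by (rule that)
qed

text \<open>Dividing the exponent in \<open>attractor_forces_decay\<close> by \<open>a\<close> gives \<open>Z(- t) \<ge> - ((\<gamma> - 4 l) / a) t - C\<close>.
  Since an attractor exists for every intensity, \<open>a\<close> may be chosen so large, independently of the
  intensities of interest, that the slope is \<open>\<delta> / 2\<close>.\<close>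

lemma noise_integral_coercive:
  assumes \<omega>: "\<omega> \<in> \<Omega>" and \<delta>: "0 < \<delta>"
  shows "filterlim (\<lambda>t. Z \<omega> (- t) + \<delta> * t) at_top at_top"
proof -
  define d where "d = \<gamma> - 4 * l"
  have d: "0 < d" using pos by (simp add: d_def)
  define a where "a = 2 * d / \<delta>"
  have a: "0 < a" "d / a = \<delta> / 2" using d \<delta> by (simp_all add: a_def)
  obtain C where C: "\<forall>\<^sub>F t in at_top. exp (- a * Z \<omega> (- t) - d * t) \<le> C"
    unfolding d_def by (rule attractor_forces_decay[OF \<omega> a(1)])
  have lim: "filterlim (\<lambda>t. \<delta> / 2 * t - C / a) at_top at_top"
    using \<delta> by real_asymp
  show ?thesis
  proof (rule filterlim_at_top_mono[OF lim])
    show "\<forall>\<^sub>F t in at_top. \<delta> / 2 * t - C / a \<le> Z \<omega> (- t) + \<delta> * t"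
      using C
    proof eventually_elim
      fix t assume "exp (- a * Z \<omega> (- t) - d * t) \<le> C"
      then have "- a * Z \<omega> (- t) - d * t \<le> C"
        using exp_ge_add_one_self[of "- a * Z \<omega> (- t) - d * t"] by linarith
      then have "- C \<le> a * Z \<omega> (- t) + d * t"
        by simp
      then have "- C / a \<le> (a * Z \<omega> (- t) + d * t) / a"
        using a by (intro divide_right_mono) auto
      also have "\<dots> = Z \<omega> (- t) + d / a * t"
        using a by (simp add: add_divide_distrib)
      finally show "\<delta> / 2 * t - C / a \<le> Z \<omega> (- t) + \<delta> * t"
        unfolding a(2) by (simp add: field_simps)
    qed
  qed
qed

text \<open>As \<open>- Z \<omega> (- s)\<close> is the integral of the noise over \<open>[- s, 0]\<close>, the mean of the noise over every
  interval of the past that ends at the present is at most \<open>\<delta>\<close>. The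
  property refers to the path alone, not to the orbit or the time by which it was reached.\<close>

definition favourable :: "real \<Rightarrow> (real \<Rightarrow> real) \<Rightarrow> bool" where
  "favourable \<delta> \<omega> \<longleftrightarrow> (\<forall>s\<ge>0. - Z \<omega> (- s) \<le> \<delta> * s)"

text \<open>A favourable time is a point where \<open>Z(- t) + \<delta> t\<close> is minimal on \<open>[T, \<infinity>)\<close>; coercivity provides
  a minimiser for every \<open>T\<close>.\<close>

lemma favourable_times_unbounded:
  assumes \<omega>: "\<omega> \<in> \<Omega>" and \<delta>: "0 < \<delta>"
  obtains t where "T \<le> t" "favourable \<delta> (shift (- t) \<omega>)"
proof -
  define f where "f = (\<lambda>t. Z \<omega> (- t) + \<delta> * t)"
  \<comment> \<open>Beyond \<open>T1\<close> the function does not fall below its value at \<open>T\<close>, so a compact interval suffices.\<close>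
  have "\<forall>\<^sub>F t in at_top. f T \<le> f t"
    using noise_integral_coercive[OF assms] unfolding f_def filterlim_at_top by blast
  then obtain T1 where T1: "\<And>s. T1 \<le> s \<Longrightarrow> f T \<le> f s"
    by (auto simp: eventually_at_top_linorder)
  have "continuous_on {T..max T T1} f"
    unfolding f_def
    by (intro continuous_intros continuous_on_compose2[OF continuous_Z[OF \<omega>, of UNIV]]) auto
  then obtain t where t: "t \<in> {T..max T T1}" "\<forall>s\<in>{T..max T T1}. f t \<le> f s"
    using continuous_attains_inf[of "{T..max T T1}" f] by auto
  have min: "f t \<le> f s" if "T \<le> s" for s
  proof (cases "s \<le> max T T1")
    case False
    then show ?thesis using t(2)[rule_format, of T] T1[of s] by force
  qed (use t(2) that in auto)
  have "- Z (shift (- t) \<omega>) (- s) \<le> \<delta> * s" if "0 \<le> s" for s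
    using min[of "t + s"] t(1) that by (simp add: Z_shift[OF \<omega>] f_def algebra_simps)
  then show ?thesis
    using t(1) by (intro that[of t]) (auto simp: favourable_def)
qed

section \<open>Bounds uniform in the noise intensity\<close>

text \<open>With the threshold \<open>(\<gamma> - 4 l) / (8 b)\<close> the multiplicative noise costs a quarter of the decay
  rate \<open>\<gamma> - 4 l\<close>, and the growth \<open>e s\<close> of the noise in the forcing costs another quarter; the rate
  that remains for the forced part is a half, which leads to the constant \<open>2\<close>.\<close>

lemma pullback_energy_estimate:
  assumes \<omega>: "\<omega> \<in> \<Omega>" and a: "0 < a" "a \<le> b" and T: "0 \<le> T"
    and fav: "favourable ((\<gamma> - 4 * l) / (8 * b)) \<omega>"
    and noise: "\<And>s. 0 \<le> s \<Longrightarrow> \<bar>z \<omega> (- s)\<bar> \<le> B + e * s" and e: "8 * b * e \<le> \<gamma> - 4 * l"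
  defines "d \<equiv> \<gamma> - 4 * l"
  shows "(norm (\<Phi> a T (shift (- T) \<omega>) y))\<^sup>2 \<le>
    exp (- (3 / 4 * d) * T) * (norm y)\<^sup>2 + 2 * (norm g)\<^sup>2 / d\<^sup>2 * exp (2 * b * B)"
proof -
  define \<omega>' where "\<omega>' = shift (- T) \<omega>"
  have \<omega>': "\<omega>' \<in> \<Omega>" unfolding \<omega>'_def by (rule shift_mem[OF \<omega>])
  have z': "z \<omega>' \<tau> = z \<omega> (\<tau> - T)" for \<tau>
    by (simp add: \<omega>'_def shift_shift)
  have d: "0 < d" using pos by (simp add: d_def)
  have aZ: "- (2 * a * Z \<omega> (- s)) \<le> d / 4 * s" if "0 \<le> s" for s
  proof -
    have "a * (- Z \<omega> (- s)) \<le> a * (d / (8 * b) * s)"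
      using fav that a by (intro mult_left_mono) (auto simp: favourable_def d_def)
    also have "\<dots> \<le> b * (d / (8 * b) * s)"
      using a d that by (intro mult_right_mono) auto
    also have "\<dots> = d / 8 * s"
      using a by simp
    finally show ?thesis by simp
  qed
  define Q where "Q = (norm g)\<^sup>2 / d * exp (2 * b * B)"
  have Q: "0 \<le> Q" using d by (simp add: Q_def)
  define \<phi> where "\<phi> = (\<lambda>\<tau>. \<Phi> a \<tau> \<omega>' y)"
  define E where "E = (\<lambda>\<tau>. 2 * a * Z \<omega> (\<tau> - T) - d * (\<tau> - T))"
  define G where "G = (\<lambda>\<tau>. Q * (2 / d) * exp (d / 2 * (\<tau> - T)))"
  have "exp (- E T) * (norm (\<phi> T))\<^sup>2 \<le> exp (- E 0) * (norm (\<phi> 0))\<^sup>2 + (G T - G 0)"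
  proof (rule differential_inequality[OF T])
    fix \<tau> assume \<tau>: "\<tau> \<in> {0..T}"
    define F where "F = 2 * inner (\<phi> \<tau>) (lattice_rhs l \<mu> \<gamma> \<beta> k \<nu> p g a (z \<omega>' \<tau>) (\<phi> \<tau>))"
    show "((\<lambda>\<tau>. (norm (\<phi> \<tau>))\<^sup>2) has_real_derivative
        2 * inner (\<phi> \<tau>) (lattice_rhs l \<mu> \<gamma> \<beta> k \<nu> p g a (z \<omega>' \<tau>) (\<phi> \<tau>))) (at \<tau> within {0..T})"
      unfolding \<phi>_def by (intro norm_sq_has_real_derivative solution a \<omega>' \<tau>)
    have "((\<lambda>\<tau>. Z \<omega> (\<tau> - T)) has_real_derivative z \<omega> (\<tau> - T) * 1) (at \<tau> within {0..T})"
      by (rule DERIV_chain2[OF Z_has_real_derivative[OF \<omega>]]) (auto intro!: derivative_eq_intros)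
    then show "(E has_real_derivative 2 * a * z \<omega>' \<tau> - d) (at \<tau> within {0..T})"
      unfolding E_def z' by (auto intro!: derivative_eq_intros)
    show "(G has_real_derivative Q * exp (d / 2 * (\<tau> - T))) (at \<tau> within {0..T})"
      unfolding G_def using d by (auto intro!: derivative_eq_intros)
    have "F - (2 * a * z \<omega>' \<tau> - d) * (norm (\<phi> \<tau>))\<^sup>2 \<le> exp (- 2 * a * z \<omega>' \<tau>) * (norm g)\<^sup>2 / d"
      using lattice_rhs_dissipative[OF pos, of "\<phi> \<tau>" \<mu> \<beta> \<nu> g a "z \<omega>' \<tau>"] unfolding F_def d_def by linarith
    then have "exp (- E \<tau>) * (F - (2 * a * z \<omega>' \<tau> - d) * (norm (\<phi> \<tau>))\<^sup>2)
        \<le> exp (- E \<tau>) * (exp (- 2 * a * z \<omega>' \<tau>) * (norm g)\<^sup>2 / d)"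
      by (intro mult_left_mono) auto
    also have "\<dots> = exp (- E \<tau> + - 2 * a * z \<omega>' \<tau>) * ((norm g)\<^sup>2 / d)"
      by (simp only: exp_add times_divide_eq_right mult.assoc)
    also have "\<dots> \<le> exp (2 * b * B + d / 2 * (\<tau> - T)) * ((norm g)\<^sup>2 / d)"
    proof (intro mult_right_mono)
      have s: "0 \<le> T - \<tau>" using \<tau> by auto
      have "\<bar>a * z \<omega> (\<tau> - T)\<bar> \<le> b * (B + e * (T - \<tau>))"
        unfolding abs_mult using noise[OF s] a by (intro mult_mono) auto
      then have "- 2 * a * z \<omega>' \<tau> \<le> 2 * (b * (B + e * (T - \<tau>)))"
        unfolding z' by linarith
      also have "\<dots> = 2 * b * B + 8 * b * e / 4 * (T - \<tau>)"
        by (simp add: algebra_simps)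
      also have "\<dots> \<le> 2 * b * B + d / 4 * (T - \<tau>)"
        using e s by (intro add_left_mono mult_right_mono) (auto simp: d_def)
      finally have "- E \<tau> + - 2 * a * z \<omega>' \<tau> \<le> d / 4 * (T - \<tau>) + d * (\<tau> - T) + (2 * b * B + d / 4 * (T - \<tau>))"
        using aZ[OF s] unfolding E_def by simp
      also have "\<dots> = 2 * b * B + d / 2 * (\<tau> - T)"
        by (simp add: field_simps)
      finally show "exp (- E \<tau> + - 2 * a * z \<omega>' \<tau>) \<le> exp (2 * b * B + d / 2 * (\<tau> - T))"
        by (simp only: exp_le_cancel_iff)
    qed (use d in simp)
    also have "\<dots> = Q * exp (d / 2 * (\<tau> - T))"
      by (simp add: Q_def exp_add)
    finally show "exp (- E \<tau>) * (2 * inner (\<phi> \<tau>) (lattice_rhs l \<mu> \<gamma> \<beta> k \<nu> p g a (z \<omega>' \<tau>) (\<phi> \<tau>))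
        - (2 * a * z \<omega>' \<tau> - d) * (norm (\<phi> \<tau>))\<^sup>2) \<le> Q * exp (d / 2 * (\<tau> - T))"
      unfolding F_def .
  qed
  moreover have "\<phi> 0 = y"
    unfolding \<phi>_def by (rule solution(1)[OF a(1) \<omega>'])
  moreover have "0 \<le> G 0"
    using d Q by (simp add: G_def)
  moreover have "E T = 0"
    by (simp add: E_def Z_0)
  moreover have "exp (- E 0) * (norm y)\<^sup>2 \<le> exp (- (3 / 4 * d) * T) * (norm y)\<^sup>2"
    using aZ[OF T] by (intro mult_right_mono) (auto simp: E_def)
  moreover have "G T = 2 * (norm g)\<^sup>2 / d\<^sup>2 * exp (2 * b * B)"
    by (simp add: G_def Q_def power2_eq_square)
  ultimately show ?thesis
    unfolding \<phi>_def \<omega>'_def by simp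
qed

text \<open>Points of the attractor can be pulled back along the flow for arbitrarily long times \<open>T\<close>. As the
  attractor is tempered, the contribution of the initial datum vanishes when \<open>T \<rightarrow> \<infinity>\<close>, and a bound
  remains in which the intensity \<open>a\<close> enters only through its upper bound \<open>b\<close>.\<close>

lemma attractor_bound:
  assumes \<omega>: "\<omega> \<in> \<Omega>" and a: "0 < a" "a \<le> b"
    and fav: "favourable ((\<gamma> - 4 * l) / (8 * b)) \<omega>"
    and noise: "\<And>s. 0 \<le> s \<Longrightarrow> \<bar>z \<omega> (- s)\<bar> \<le> B + e * s" and e: "8 * b * e \<le> \<gamma> - 4 * l"
    and x: "x \<in> A a \<omega>"
  shows "(norm x)\<^sup>2 \<le> 2 * (norm g)\<^sup>2 / (\<gamma> - 4 * l)\<^sup>2 * exp (2 * b * B)"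
proof -
  define d where "d = \<gamma> - 4 * l"
  have d: "0 < d" using pos by (simp add: d_def)
  define Q where "Q = 2 * (norm g)\<^sup>2 / d\<^sup>2 * exp (2 * b * B)"
  have "\<forall>\<^sub>F T in at_top. \<forall>y\<in>A a (shift (- T) \<omega>). norm y \<le> exp (d / 4 * T)"
    using d by (intro attractor_growth a \<omega>) simp
  then have "\<forall>\<^sub>F T in at_top. (norm x)\<^sup>2 \<le> exp (- (d / 4) * T) + Q"
    using eventually_ge_at_top[of 0]
  proof eventually_elim
    fix T :: real assume growth: "\<forall>y\<in>A a (shift (- T) \<omega>). norm y \<le> exp (d / 4 * T)" and T: "0 \<le> T"
    have "\<Phi> a T (shift (- T) \<omega>) ` A a (shift (- T) \<omega>) = A a \<omega>"
      using attractor_invariant[OF a(1) shift_mem[OF \<omega>] T, of "- T"] by (simp add: shift_shift shift_0 \<omega>)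
    then obtain y where y: "y \<in> A a (shift (- T) \<omega>)" "x = \<Phi> a T (shift (- T) \<omega>) y"
      using x by blast
    have "(norm x)\<^sup>2 \<le> exp (- (3 / 4 * d) * T) * (norm y)\<^sup>2 + Q"
      unfolding y(2) Q_def d_def by (rule pullback_energy_estimate[OF \<omega> a T fav noise e])
    also have "exp (- (3 / 4 * d) * T) * (norm y)\<^sup>2 \<le> exp (- (3 / 4 * d) * T) * (exp (d / 4 * T))\<^sup>2"
      using growth y(1) by (intro mult_left_mono power_mono) auto
    also have "\<dots> = exp (- (d / 4) * T)"
      unfolding exp_double[symmetric] exp_add[symmetric] by (simp add: field_simps)
    finally show "(norm x)\<^sup>2 \<le> exp (- (d / 4) * T) + Q"
      by simp
  qed
  moreover have "((\<lambda>T. exp (- (d / 4) * T) + Q) \<longlongrightarrow> 0 + Q) at_top"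
  proof (intro tendsto_intros)
    show "((\<lambda>T. exp (- (d / 4) * T)) \<longlongrightarrow> 0) at_top"
      using d by real_asymp
  qed
  ultimately have "(norm x)\<^sup>2 \<le> 0 + Q"
    by (intro tendsto_lowerbound) auto
  then show ?thesis
    by (simp add: Q_def d_def)
qed

text \<open>The bound for a favourable path depends exponentially on the size of the noise in its past. At
  time \<open>- t\<close> this size is at most \<open>C + e t\<close> with \<open>e\<close> arbitrarily small, whence subexponential growth
  in \<open>t\<close>, with one constant for all intensities up to \<open>b\<close>.\<close>

lemma attractors_uniformly_tempered:
  assumes \<omega>: "\<omega> \<in> \<Omega>" and b: "0 < b" and \<rho>: "0 < \<rho>"
  obtains K where "0 \<le> K"
    "\<And>a t x. \<lbrakk>0 < a; a \<le> b; 0 \<le> t; favourable ((\<gamma> - 4 * l) / (8 * b)) (shift (- t) \<omega>);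
      x \<in> A a (shift (- t) \<omega>)\<rbrakk> \<Longrightarrow> norm x \<le> K * exp (\<rho> * t)"
proof -
  define d where "d = \<gamma> - 4 * l"
  have d: "0 < d" using pos by (simp add: d_def)
  define e where "e = min (d / (8 * b)) (\<rho> / b)"
  have e: "0 < e" "8 * b * e \<le> d" "b * e \<le> \<rho>"
    using b d \<rho> by (simp_all add: e_def min_def field_simps)
  obtain C where C: "0 \<le> C" "\<And>t. t \<le> 0 \<Longrightarrow> \<bar>z \<omega> t\<bar> \<le> C + e * \<bar>t\<bar>"
    by (rule noise_growth[OF \<omega> e(1)]) blast
  define Q where "Q = 2 * (norm g)\<^sup>2 / d\<^sup>2 * exp (2 * b * C)"
  have Q: "0 \<le> Q" by (simp add: Q_def)
  show ?thesis
  proof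
    show "0 \<le> sqrt Q" using Q by simp
    fix a t x
    assume a: "0 < a" "a \<le> b" and t: "0 \<le> t" and fav: "favourable ((\<gamma> - 4 * l) / (8 * b)) (shift (- t) \<omega>)"
      and x: "x \<in> A a (shift (- t) \<omega>)"
    have "(norm x)\<^sup>2 \<le> 2 * (norm g)\<^sup>2 / (\<gamma> - 4 * l)\<^sup>2 * exp (2 * b * (C + e * t))"
    proof (rule attractor_bound[OF shift_mem[OF \<omega>] a fav _ _ x])
      show "\<bar>z (shift (- t) \<omega>) (- s)\<bar> \<le> C + e * t + e * s" if "0 \<le> s" for s
      proof -
        have "\<bar>- t - s\<bar> = t + s"
          using t that by simp
        then show ?thesis
          using C(2)[of "- t - s"] t that by (simp add: shift_shift distrib_left)
      qed
      show "8 * b * e \<le> \<gamma> - 4 * l"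
        using e(2) by (simp add: d_def)
    qed
    also have "\<dots> = Q * exp (2 * (b * e * t))"
      by (simp add: Q_def d_def distrib_left exp_add mult.assoc)
    also have "\<dots> \<le> Q * exp (2 * (\<rho> * t))"
    proof -
      have "b * e * t \<le> \<rho> * t"
        using e(3) t by (rule mult_right_mono)
      then show ?thesis
        by (intro mult_left_mono Q) simp
    qed
    also have "\<dots> = (sqrt Q * exp (\<rho> * t))\<^sup>2"
      using Q by (simp add: power_mult_distrib exp_double)
    finally show "norm x \<le> sqrt Q * exp (\<rho> * t)"
      by (rule power2_le_imp_le) (use Q in simp)
  qed
qed

section \<open>Upper semicontinuity\<close>

text \<open>Both solutions stay in one ball by the energy bound, on which the right-hand side is
  Lipschitz in state and intensity.\<close>

lemma solution_lipschitz_in_intensity: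
  assumes \<omega>: "\<omega> \<in> \<Omega>" and t: "0 \<le> t" and b: "0 \<le> b" and R: "0 \<le> R"
  obtains K where
    "\<And>a a' y. \<lbrakk>0 < a; a \<le> b; 0 < a'; a' \<le> b; norm y \<le> R\<rbrakk> \<Longrightarrow>
      norm (\<Phi> a t \<omega> y - \<Phi> a' t \<omega> y) \<le> K * \<bar>a - a'\<bar>"
proof -
  obtain B where B: "0 \<le> B" "\<And>\<tau>. \<tau> \<in> {0..t} \<Longrightarrow> \<bar>z \<omega> \<tau>\<bar> \<le> B"
    by (rule noise_bounded[OF \<omega>, of t]) blast
  obtain M where M: "0 \<le> M"
    "\<And>a \<tau> y. \<lbrakk>0 < a; a \<le> b; norm y \<le> R; \<tau> \<in> {0..t}\<rbrakk> \<Longrightarrow> norm (\<Phi> a \<tau> \<omega> y) \<le> M"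
    by (rule solution_bounded[OF \<omega> b R, of t]) blast
  obtain L K where L: "0 \<le> L" "0 \<le> K"
    and lip: "\<And>a a' x U V. \<lbrakk>0 \<le> a; a \<le> b; 0 \<le> a'; a' \<le> b; \<bar>x\<bar> \<le> B; norm U \<le> M; norm V \<le> M\<rbrakk> \<Longrightarrow>
      norm (lattice_rhs l \<mu> \<gamma> \<beta> k \<nu> p g a x U - lattice_rhs l \<mu> \<gamma> \<beta> k \<nu> p g a' x V)
        \<le> L * norm (U - V) + K * \<bar>a - a'\<bar>"
    by (rule lattice_rhs_lipschitz[OF pos(3) b M(1) B(1)]) blast
  show ?thesis
  proof
    fix a a' :: real and y :: ell2
    assume a: "0 < a" "a \<le> b" "0 < a'" "a' \<le> b" and y: "norm y \<le> R"
    define W where "W = (\<lambda>\<tau>. \<Phi> a \<tau> \<omega> y - \<Phi> a' \<tau> \<omega> y)"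
    define W' where "W' = (\<lambda>\<tau>. lattice_rhs l \<mu> \<gamma> \<beta> k \<nu> p g a (z \<omega> \<tau>) (\<Phi> a \<tau> \<omega> y)
      - lattice_rhs l \<mu> \<gamma> \<beta> k \<nu> p g a' (z \<omega> \<tau>) (\<Phi> a' \<tau> \<omega> y))"
    have "norm (W t) \<le> (norm (W 0) + (K * \<bar>a - a'\<bar>) * sqrt t) * sqrt (exp ((2 * L + 1) * t))"
    proof (rule norm_gronwall[OF t L(1)])
      show "0 \<le> K * \<bar>a - a'\<bar>" using L by simp
      fix \<tau> assume \<tau>: "\<tau> \<in> {0..t}"
      show "(W has_vector_derivative W' \<tau>) (at \<tau> within {0..t})"
        unfolding W_def W'_def by (intro has_vector_derivative_diff solution a \<omega> \<tau>)
      show "norm (W' \<tau>) \<le> L * norm (W \<tau>) + K * \<bar>a - a'\<bar>"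
        unfolding W_def W'_def using a by (intro lip B(2) \<tau> M(2) y) auto
    qed
    then show "norm (\<Phi> a t \<omega> y - \<Phi> a' t \<omega> y) \<le> (K * sqrt t * sqrt (exp ((2 * L + 1) * t))) * \<bar>a - a'\<bar>"
      by (simp add: W_def solution(1)[OF a(1) \<omega>] solution(1)[OF a(3) \<omega>] ac_simps)
  qed
qed

text \<open>Along a sequence \<open>t n\<close> of favourable times the union of all attractors with intensity in
  \<open>(0, b]\<close> is taken; on all other paths the set is \<open>{0}\<close>. The result is measurable because only
  countably many paths are special. It is tempered along every orbit, not only that of \<open>\<omega>\<close>, because each
  special path is favourable, a property under which the attractors over any orbit grow
  subexponentially.\<close>

lemma common_tempered_set:
  assumes \<omega>: "\<omega> \<in> \<Omega>" and b: "0 < b"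
  obtains D where "D \<in> tempered_universe P \<Omega>"
    and "\<And>T. \<exists>t\<ge>T. 0 \<le> t \<and> bounded (D (shift (- t) \<omega>)) \<and>
      (\<forall>a. 0 < a \<longrightarrow> a \<le> b \<longrightarrow> A a (shift (- t) \<omega>) \<subseteq> D (shift (- t) \<omega>))"
proof -
  define \<delta> where "\<delta> = (\<gamma> - 4 * l) / (8 * b)"
  have "0 < \<delta>" using pos b by (simp add: \<delta>_def)
  then have "\<exists>t\<ge>real n. favourable \<delta> (shift (- t) \<omega>)" for n
    using favourable_times_unbounded[OF \<omega>] by metis
  then obtain t where t: "\<And>n. real n \<le> t n" "\<And>n. favourable \<delta> (shift (- t n) \<omega>)"
    by metis
  have t0: "0 \<le> t n" for n
    using t(1)[of n] by (meson of_nat_0_le_iff order_trans)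
  define S where "S = range (\<lambda>n. shift (- t n) \<omega>)"
  define D where "D = (\<lambda>\<omega>'. if \<omega>' \<in> S then closure (\<Union>a\<in>{0<..b}. A a \<omega>') else {0})"
  have S: "S \<subseteq> \<Omega>" "countable S" "\<And>\<omega>'. \<omega>' \<in> S \<Longrightarrow> favourable \<delta> \<omega>'"
    using shift_mem[OF \<omega>] t(2) by (auto simp: S_def)
  have D_subset: "D (shift (- s) \<omega>') \<subseteq> cball 0 (K * exp (\<rho> * s))"
    if "0 \<le> K" "0 \<le> s"
      and K: "\<And>a t x. \<lbrakk>0 < a; a \<le> b; 0 \<le> t; favourable \<delta> (shift (- t) \<omega>'); x \<in> A a (shift (- t) \<omega>')\<rbrakk>
        \<Longrightarrow> norm x \<le> K * exp (\<rho> * t)"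
    for K \<rho> s \<omega>'
  proof (cases "shift (- s) \<omega>' \<in> S")
    case True
    then have "D (shift (- s) \<omega>') = closure (\<Union>a\<in>{0<..b}. A a (shift (- s) \<omega>'))"
      by (simp add: D_def)
    also have "\<dots> \<subseteq> cball 0 (K * exp (\<rho> * s))"
      using K[OF _ _ \<open>0 \<le> s\<close> S(3)[OF True]] by (intro closure_minimal) auto
    finally show ?thesis .
  next
    case False
    then show ?thesis using that(1) by (simp add: D_def)
  qed
  have absorbs: "\<exists>s\<ge>T. 0 \<le> s \<and> bounded (D (shift (- s) \<omega>)) \<and>
      (\<forall>a. 0 < a \<longrightarrow> a \<le> b \<longrightarrow> A a (shift (- s) \<omega>) \<subseteq> D (shift (- s) \<omega>))" for T
  proof -
    obtain n :: nat where n: "T \<le> real n"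
      using real_arch_simple by blast
    obtain K where "0 \<le> K"
      "\<And>a t x. \<lbrakk>0 < a; a \<le> b; 0 \<le> t; favourable \<delta> (shift (- t) \<omega>); x \<in> A a (shift (- t) \<omega>)\<rbrakk>
        \<Longrightarrow> norm x \<le> K * exp (1 * t)"
      unfolding \<delta>_def by (rule attractors_uniformly_tempered[OF \<omega> b zero_less_one]) blast
    then have "bounded (D (shift (- t n) \<omega>))"
      using t0 by (intro bounded_subset[OF bounded_cball D_subset[where \<rho> = 1]]) auto
    moreover have "A a (shift (- t n) \<omega>) \<subseteq> D (shift (- t n) \<omega>)" if "0 < a" "a \<le> b" for a
    proof -
      have "A a (shift (- t n) \<omega>) \<subseteq> (\<Union>a\<in>{0<..b}. A a (shift (- t n) \<omega>))"
        using that by auto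
      also have "\<dots> \<subseteq> D (shift (- t n) \<omega>)"
        by (simp add: D_def S_def closure_subset)
      finally show ?thesis .
    qed
    ultimately show ?thesis
      using order_trans[OF n t(1)] t0 by blast
  qed
  have "tempered \<Omega> D"
    unfolding tempered_def
  proof (intro ballI allI impI)
    fix \<omega>' and \<rho> :: real assume \<omega>': "\<omega>' \<in> \<Omega>" and \<rho>: "0 < \<rho>"
    obtain K where K: "0 \<le> K"
      "\<And>a t x. \<lbrakk>0 < a; a \<le> b; 0 \<le> t; favourable \<delta> (shift (- t) \<omega>'); x \<in> A a (shift (- t) \<omega>')\<rbrakk>
        \<Longrightarrow> norm x \<le> K * exp (\<rho> / 2 * t)"
      unfolding \<delta>_def by (rule attractors_uniformly_tempered[OF \<omega>' b half_gt_zero[OF \<rho>]]) blast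
    show "((\<lambda>t. ennreal (exp (- \<rho> * t)) * (SUP \<phi>\<in>D (shift (- t) \<omega>'). ennreal (norm \<phi>))) \<longlongrightarrow> 0) at_top"
    proof (rule tendsto_sandwich[OF _ _ tendsto_const])
      show "\<forall>\<^sub>F t in at_top. ennreal (exp (- \<rho> * t)) * (SUP \<phi>\<in>D (shift (- t) \<omega>'). ennreal (norm \<phi>))
          \<le> ennreal (K * exp (- (\<rho> / 2) * t))"
        using eventually_ge_at_top[of 0]
      proof eventually_elim
        fix t :: real assume t: "0 \<le> t"
        have "D (shift (- t) \<omega>') \<subseteq> cball 0 (K * exp (\<rho> / 2 * t))"
          by (rule D_subset[OF K(1) t K(2)])
        then have "(SUP \<phi>\<in>D (shift (- t) \<omega>'). ennreal (norm \<phi>)) \<le> ennreal (K * exp (\<rho> / 2 * t))"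
          by (intro SUP_least ennreal_leI) auto
        then have "ennreal (exp (- \<rho> * t)) * (SUP \<phi>\<in>D (shift (- t) \<omega>'). ennreal (norm \<phi>))
            \<le> ennreal (exp (- \<rho> * t)) * ennreal (K * exp (\<rho> / 2 * t))"
          by (intro mult_left_mono) auto
        also have "\<dots> = ennreal (exp (- \<rho> * t) * (K * exp (\<rho> / 2 * t)))"
          using K(1) by (intro ennreal_mult[symmetric]) auto
        also have "exp (- \<rho> * t) * (K * exp (\<rho> / 2 * t)) = K * exp (- \<rho> * t + \<rho> / 2 * t)"
          by (simp only: exp_add mult.left_commute)
        also have "- \<rho> * t + \<rho> / 2 * t = - (\<rho> / 2) * t"
          by simp
        finally show "ennreal (exp (- \<rho> * t)) * (SUP \<phi>\<in>D (shift (- t) \<omega>'). ennreal (norm \<phi>))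
          \<le> ennreal (K * exp (- (\<rho> / 2) * t))" .
      qed
      have "((\<lambda>t. K * exp (- (\<rho> / 2) * t)) \<longlongrightarrow> 0) at_top"
      proof (rule tendsto_mult_right_zero)
        show "((\<lambda>t. exp (- (\<rho> / 2) * t)) \<longlongrightarrow> 0) at_top"
          using \<rho> by real_asymp
      qed
      then show "((\<lambda>t. ennreal (K * exp (- (\<rho> / 2) * t))) \<longlongrightarrow> 0) at_top"
        using tendsto_ennrealI by fastforce
    qed auto
  qed
  moreover have "closed_random_set P \<Omega> D"
    unfolding closed_random_set_def
  proof (intro conjI ballI allI)
    fix \<omega>' assume \<omega>': "\<omega>' \<in> \<Omega>"
    have "A b \<omega>' \<noteq> {}"
      using attractor[OF b] \<omega>' by (auto simp: random_attractor_def tempered_universe_def closed_random_set_def)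
    then show "closed (D \<omega>')" "D \<omega>' \<noteq> {}"
      using b by (auto simp: D_def)
  next
    fix x
    have \<Omega>: "\<Omega> \<in> sets P"
      using admissible by (simp add: admissible_paths_def)
    show "(\<lambda>\<omega>. infdist x (D \<omega>)) \<in> borel_measurable (restrict_space P \<Omega>)"
    proof (rule measurable_discrete_difference[where f = "\<lambda>_. infdist x {0}" and X = S])
      show "{\<omega>'} \<in> sets (restrict_space P \<Omega>)" if "\<omega>' \<in> S" for \<omega>'
      proof -
        have "\<omega>' \<in> \<Omega>" using that S by blast
        moreover have "{\<omega>'} \<in> sets P"
          using \<open>\<omega>' \<in> \<Omega>\<close> sets.sets_into_space[OF \<Omega>] by (intro singleton_in_sets_wiener wiener) auto
        ultimately show ?thesis
          using \<Omega> by (simp add: sets_restrict_space_iff)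
      qed
    qed (auto simp: D_def S)
  qed
  ultimately have "D \<in> tempered_universe P \<Omega>"
    by (simp add: tempered_universe_def)
  then show ?thesis
    by (rule that[OF _ absorbs])
qed

text \<open>Going back by a large but fixed time \<open>t\<close>, all attractors with intensity near \<open>a0\<close> lie in one
  bounded set which \<open>\<Phi> a0 t\<close> carries into a small neighbourhood of \<open>A a0 \<omega>\<close>. For \<open>a\<close> close to
  \<open>a0\<close>, \<open>\<Phi> a t\<close> does nearly the same on that set, and by invariance it carries \<open>A a (shift (- t) \<omega>)\<close>
  onto \<open>A a \<omega>\<close>.\<close>

lemma attractors_close:
  assumes \<omega>: "\<omega> \<in> \<Omega>" and a0: "0 < a0" and \<eta>: "0 < \<eta>"
  shows "\<forall>\<^sub>F a in at a0. semi_dist (A a \<omega>) (A a0 \<omega>) \<le> ennreal \<eta>"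
proof -
  define b where "b = 2 * a0"
  have b: "0 < b" "a0 \<le> b" using a0 by (simp_all add: b_def)
  obtain D where D: "D \<in> tempered_universe P \<Omega>"
    "\<And>T. \<exists>t\<ge>T. 0 \<le> t \<and> bounded (D (shift (- t) \<omega>)) \<and>
      (\<forall>a. 0 < a \<longrightarrow> a \<le> b \<longrightarrow> A a (shift (- t) \<omega>) \<subseteq> D (shift (- t) \<omega>))"
    by (rule common_tempered_set[OF \<omega> b(1)]) blast
  from attractor_attracts[OF a0 \<omega> D(1)] have "\<forall>\<^sub>F t in at_top. semi_dist (\<Phi> a0 t (shift (- t) \<omega>) ` D (shift (- t) \<omega>)) (A a0 \<omega>) < ennreal (\<eta> / 2)"
    using \<eta> by (intro order_tendstoD) auto
  then obtain T where T: "\<And>t. T \<le> t \<Longrightarrow>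
      semi_dist (\<Phi> a0 t (shift (- t) \<omega>) ` D (shift (- t) \<omega>)) (A a0 \<omega>) < ennreal (\<eta> / 2)"
    by (auto simp: eventually_at_top_linorder)
  obtain t where t: "T \<le> t" "0 \<le> t" "bounded (D (shift (- t) \<omega>))"
    "\<And>a. \<lbrakk>0 < a; a \<le> b\<rbrakk> \<Longrightarrow> A a (shift (- t) \<omega>) \<subseteq> D (shift (- t) \<omega>)"
    using D(2)[of T] by blast
  define \<omega>' where "\<omega>' = shift (- t) \<omega>"
  have \<omega>': "\<omega>' \<in> \<Omega>" "shift t \<omega>' = \<omega>"
    unfolding \<omega>'_def by (simp_all add: shift_mem \<omega> shift_shift shift_0)
  obtain R where R: "0 \<le> R" "\<And>y. y \<in> D \<omega>' \<Longrightarrow> norm y \<le> R"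
    using t(3) unfolding \<omega>'_def bounded_pos by (meson less_imp_le)
  obtain K where K:
    "\<And>a a' y. \<lbrakk>0 < a; a \<le> b; 0 < a'; a' \<le> b; norm y \<le> R\<rbrakk> \<Longrightarrow>
      norm (\<Phi> a t \<omega>' y - \<Phi> a' t \<omega>' y) \<le> K * \<bar>a - a'\<bar>"
    by (rule solution_lipschitz_in_intensity[OF \<omega>'(1) t(2) less_imp_le[OF b(1)] R(1)]) blast
  have "\<forall>\<^sub>F a in at a0. a \<in> {0<..<b} \<and> K * \<bar>a - a0\<bar> < \<eta> / 2"
  proof (intro eventually_conj)
    show "\<forall>\<^sub>F a in at a0. a \<in> {0<..<b}"
      using a0 by (intro eventually_at_in_open') (auto simp: b_def)
    have "((\<lambda>a. K * \<bar>a - a0\<bar>) \<longlongrightarrow> K * \<bar>a0 - a0\<bar>) (at a0)"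
      by (intro tendsto_intros)
    then show "\<forall>\<^sub>F a in at a0. K * \<bar>a - a0\<bar> < \<eta> / 2"
      using \<eta> by (intro order_tendstoD) auto
  qed
  then show ?thesis
  proof eventually_elim
    fix a assume a: "a \<in> {0<..<b} \<and> K * \<bar>a - a0\<bar> < \<eta> / 2"
    show "semi_dist (A a \<omega>) (A a0 \<omega>) \<le> ennreal \<eta>"
      unfolding semi_dist_def
    proof (rule SUP_least)
      fix x assume "x \<in> A a \<omega>"
      then have "x \<in> \<Phi> a t \<omega>' ` A a \<omega>'"
        using attractor_invariant[of a \<omega>' t] a \<omega>' t(2) by auto
      then obtain y where y: "y \<in> A a \<omega>'" "x = \<Phi> a t \<omega>' y"
        by blast
      have yD: "y \<in> D \<omega>'"
        using y(1) t(4)[of a] a by (auto simp: \<omega>'_def)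
      define v where "v = \<Phi> a0 t \<omega>' y"
      have "semi_dist (\<Phi> a0 t \<omega>' ` D \<omega>') (A a0 \<omega>) < ennreal (\<eta> / 2)"
        using T[OF t(1)] by (simp add: \<omega>'_def)
      moreover have "v \<in> \<Phi> a0 t \<omega>' ` D \<omega>'"
        using yD by (simp add: v_def)
      ultimately obtain w where w: "w \<in> A a0 \<omega>" "norm (v - w) < \<eta> / 2"
        by (rule semi_dist_lessE)
      have "norm (x - v) \<le> K * \<bar>a - a0\<bar>"
        unfolding y(2) v_def using a a0 b R(2)[OF yD] by (intro K) auto
      moreover note w(2)
      moreover have "norm (x - w) \<le> norm (x - v) + norm (v - w)"
        by norm
      ultimately have "norm (x - w) \<le> \<eta>"
        using a by linarith
      then have "ennreal (norm (x - w)) \<le> ennreal \<eta>"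
        by (rule ennreal_leI)
      then show "(INF w\<in>A a0 \<omega>. ennreal (norm (x - w))) \<le> ennreal \<eta>"
        by (rule INF_lower2[OF w(1)])
    qed
  qed
qed

lemma attractors_upper_semicontinuous:
  assumes "\<omega> \<in> \<Omega>" "0 < a0"
  shows "((\<lambda>a. semi_dist (A a \<omega>) (A a0 \<omega>)) \<longlongrightarrow> 0) (at a0)"
proof (rule order_tendstoI)
  fix u :: ennreal assume "0 < u"
  then obtain v where v: "0 < v" "v < u"
    using dense by blast
  then have "v < top"
    using order.strict_trans2[OF v(2) top_greatest] by simp
  then obtain \<eta> where \<eta>: "v = ennreal \<eta>" "0 \<le> \<eta>"
    by (cases v) auto
  then have "0 < \<eta>"
    using v(1) by auto
  from attractors_close[OF assms this]
  show "\<forall>\<^sub>F a in at a0. semi_dist (A a \<omega>) (A a0 \<omega>) < u"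
    by eventually_elim (use v \<eta> in auto)
qed simp

end

theorem theorem5p2:
  fixes l \<mu> \<gamma> \<beta> k \<nu> p :: real and g :: ell2
    and P :: "(real \<Rightarrow> real) measure" and \<Omega> :: "(real \<Rightarrow> real) set"
    and \<Phi> :: "real \<Rightarrow> real \<Rightarrow> (real \<Rightarrow> real) \<Rightarrow> ell2 \<Rightarrow> ell2"
    and A :: "real \<Rightarrow> (real \<Rightarrow> real) \<Rightarrow> ell2 set"
  assumes "l > 0" and "\<gamma> > 0" and "k > 0" and "p > 0" and "\<gamma> > 4 * l"
    and "two_sided_wiener_measure P"
    and "admissible_paths P \<Omega>"
    and "\<And>a. a > 0 \<Longrightarrow> generated_by \<Omega> (lattice_rhs l \<mu> \<gamma> \<beta> k \<nu> p g a) (\<Phi> a)"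
    and "\<And>a. a > 0 \<Longrightarrow> random_attractor P \<Omega> (\<Phi> a) (A a)"
  shows "\<forall>\<omega>\<in>\<Omega>. \<forall>a\<^sub>0>0. ((\<lambda>a. semi_dist (A a \<omega>) (A a\<^sub>0 \<omega>)) \<longlongrightarrow> 0) (at a\<^sub>0)"
proof -
  interpret lattice_attractors l \<mu> \<gamma> \<beta> k \<nu> p g P \<Omega> \<Phi> A
    by unfold_locales (fact assms)+
  show ?thesis
    using attractors_upper_semicontinuous by blast
qed

end
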